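(* Let $p\in\{1,2,3\}$ and $\ell\in\{1,2\}$. Let $(\mathbb S,\mathcal B(\mathbb S),\mathcal P)$ be the probability space of conductivities with push-forward prior $\mathcal P=\mathrm{Law}(F_p(X))$, $X\sim\mathcal N(0,\mathcal C)$, and let $$\Phi(y;\sigma)=\sum_{i,j=1}^d \frac{\|h_{i,j}(\sigma)-y_{i,j}\|_{L^\ell(\Omega)}^\ell}{\ell\,\tau_{i,j}^\ell},\qquad y=(y_{i,j})_{i,j=1}^d\in L^\ell(\Omega)^{d\times d},$$ be the negative log-likelihood. Then the posterior distribution $\mathcal P^{\mathrm{post}}=\mathcal P^{\mathrm{post}}_{\sigma|y}$ (the conditional probability measure of the conductivity given the measurement $y$) is absolutely continuous with respect to the prior, $\mathcal P^{\mathrm{post}}\ll\mathcal P$, and is given by the Radon–Nikodym derivative $$\frac{d\mathcal P^{\mathrm{post}}}{d\mathcal P}(\sigma)=\frac1Z\exp(-\Phi(y;\sigma)),\qquad Z=\int_{\mathbb S}\exp(-\Phi(y;\sigma))\,\mathcal P(d\sigma).$$ Furthermore, for every $r>0$ and any two sets of measurements $y^1=(y^1_{i,j})$, $y^2=(y^2_{i,j})$ with $\max_{i,j}\max\{\|y^1_{i,j}\|_{L^\ell(\Omega)},\|y^2_{i,j}\|_{L^\ell(\Omega)}\}<r$, there is a constant $C>0$, independent of $\sigma$, such that $$d_{\mathrm{Hell}}\big(\mathcal P^{\mathrm{post}}_{\sigma|y^1},\mathcal P^{\mathrm{post}}_{\sigma|y^2}\big)\le C\sum_{i,j=1}^d\|y^1_{i,j}-y^2_{i,j}\|_{L^\ell(\Omega)},$$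 where $d_{\mathrm{Hell}}$ is the Hellinger distance between probability measures.
   Context: Setting. $\Omega\subset\mathbb R^2$ is open and bounded with Lipschitz boundary, and $d\ge1$ is an integer. For a conductivity $\sigma$ on $\Omega$, $u_i=u_i(\sigma)\in H^1(\Omega)$, $i=1,\dots,d$, is the weak solution of $\nabla\cdot(\sigma\nabla u_i)=0$ in $\Omega$, $u_i=g_i$ on $\partial\Omega$. The power densities are $h_{i,j}(\sigma)=\sigma\,\nabla u_i\cdot\nabla u_j$, $1\le i,j\le d$. Standing assumptions. $0<\sigma_{\min}<\sigma<\sigma_{\max}<\infty$ for all $\sigma\in\mathbb S$. If $\ell=1$, the boundary data satisfy $g_i\in H^{1/2}(\partial\Omega)$, $i=1,\dots,d$. If $\ell=2$, they satisfy $g_i\in H^{s+1/2}(\partial\Omega)$ with $s>1$, and the regularity of the data is such that $h_{i,j}(\sigma)\in L^2(\Omega)$ for all $i,j$ and $\sigma\in\mathbb S$. The noise scales $\tau_{i,j}>0$, $\Omega$, $d$, $g_i$, $\sigma_{\min}$, $\sigma_{\max}$ are fixed. Prior. $X\sim\mathcal N(0,\mathcal C)$ is a centred Gaussian random function on $\Omega$, with values in a Hilbert function space, whose covariance operator $\mathcal C$ is symmetric, non-negative and trace-class. The conductivity is the random field $\sigma=F_p(X)$ (applied pointwise), where - $F_1(X)=\exp(X)$; - $F_2(X)=\sigma^-+(\sigma^+-\sigma^-)\mathbf 1_{[0,\infty)}(X)$; - $F_3(X)=\sigma^-+(\sigma^+-\sigma^-)\frac{1}{1+\exp(-aX)}$,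 with fixed constants $\sigma^+,\sigma^->0$ and $a>0$. The conductivity space $\mathbb S$ consists of measurable functions on $\Omega$ satisfying the bounds above, is equipped with the $L^\infty(\Omega)$ norm topology and its Borel $\sigma$-algebra $\mathcal B(\mathbb S)$, and $\mathcal P$ is the law of $F_p(X)$, regarded as a probability measure on $\mathbb S$. Posterior. The Bayesian model takes the prior $\mathcal P$ for $\sigma$ and the likelihood of the data $y$ given $\sigma$ proportional to $\exp(-\Phi(y;\sigma))$; the posterior is the resulting conditional probability measure of $\sigma$ given $y$ in the sense of Bayes' theorem. *)

theory Defs
  imports "HOL-Probability.Probability"
begin

type_synonym plane = "real^2"

section \<open>Lebesgue spaces\<close>

definition Lp :: "nat \<Rightarrow> 'a measure \<Rightarrow> ('a \<Rightarrow> real) set" where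
  "Lp p M = {f \<in> borel_measurable M. integrable M (\<lambda>x. \<bar>f x\<bar> ^ p)}"

definition Lp_norm :: "nat \<Rightarrow> 'a measure \<Rightarrow> ('a \<Rightarrow> real) \<Rightarrow> real" where
  "Lp_norm p M f = root p (\<integral>x. \<bar>f x\<bar> ^ p \<partial>M)"

text \<open>Convergence in mean square, for scalar or vector functions. The nonnegative integral keeps
  it meaningful (and false) when the difference is not square integrable.\<close>

definition L2_converges :: "'a measure \<Rightarrow> (nat \<Rightarrow> 'a \<Rightarrow> 'b::real_normed_vector) \<Rightarrow> ('a \<Rightarrow> 'b) \<Rightarrow> bool" where
  "L2_converges M f g \<longleftrightarrow> (\<lambda>n. \<integral>\<^sup>+x. ennreal ((norm (f n x - g x))\<^sup>2) \<partial>M) \<longlonglongrightarrow> 0"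

section \<open>Smooth functions, weak derivatives and Sobolev spaces\<close>

definition partial :: "2 \<Rightarrow> (plane \<Rightarrow> real) \<Rightarrow> plane \<Rightarrow> real" where
  "partial i f x = frechet_derivative f (at x) (axis i 1)"

primrec C_k :: "nat \<Rightarrow> (plane \<Rightarrow> real) \<Rightarrow> bool" where
  "C_k 0 f \<longleftrightarrow> continuous_on UNIV f"
| "C_k (Suc k) f \<longleftrightarrow> (\<forall>x. f differentiable (at x)) \<and> (\<forall>i. C_k k (partial i f))"

definition smooth :: "(plane \<Rightarrow> real) \<Rightarrow> bool" where
  "smooth f \<longleftrightarrow> (\<forall>k. C_k k f)"

definition test_function :: "plane set \<Rightarrow> (plane \<Rightarrow> real) \<Rightarrow> bool" where
  "test_function \<Omega> \<phi> \<longleftrightarrow> smooth \<phi> \<and> (\<exists>K. compact K \<and> K \<subseteq> \<Omega> \<and> (\<forall>x. x \<notin> K \<longrightarrow> \<phi> x = 0))"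

definition has_weak_partial :: "plane set \<Rightarrow> 2 \<Rightarrow> (plane \<Rightarrow> real) \<Rightarrow> (plane \<Rightarrow> real) \<Rightarrow> bool" where
  "has_weak_partial \<Omega> i u w \<longleftrightarrow>
     u \<in> Lp 2 (lebesgue_on \<Omega>) \<and> w \<in> Lp 2 (lebesgue_on \<Omega>) \<and>
     (\<forall>\<phi>. test_function \<Omega> \<phi> \<longrightarrow>
        (\<integral>x. u x * partial i \<phi> x \<partial>lebesgue_on \<Omega>) = - (\<integral>x. w x * \<phi> x \<partial>lebesgue_on \<Omega>))"

text \<open>The weak gradient is determined only up to a null set; some representative is chosen.\<close>

definition grad :: "plane set \<Rightarrow> (plane \<Rightarrow> real) \<Rightarrow> plane \<Rightarrow> plane" where
  "grad \<Omega> u x = (\<chi> i. (SOME w. has_weak_partial \<Omega> i u w) x)"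

text \<open>Sobolev-Slobodeckij spaces of order \<open>k + \<theta>\<close> with \<open>0 \<le> \<theta> < 1\<close>: all weak derivatives
  of order at most \<open>k\<close> are square integrable and, if \<open>\<theta> > 0\<close>, those of order \<open>k\<close> have a
  finite Gagliardo seminorm (in dimension two the exponent is \<open>2 + 2\<theta>\<close>).\<close>

primrec slobodeckij :: "plane set \<Rightarrow> nat \<Rightarrow> real \<Rightarrow> (plane \<Rightarrow> real) set" where
  "slobodeckij \<Omega> 0 \<theta> = {u \<in> Lp 2 (lebesgue_on \<Omega>). \<theta> > 0 \<longrightarrow>
     (\<integral>\<^sup>+x. \<integral>\<^sup>+y. ennreal ((u x - u y)\<^sup>2 / dist x y powr (2 + 2 * \<theta>)) \<partial>lebesgue_on \<Omega> \<partial>lebesgue_on \<Omega>) < \<infinity>}"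
| "slobodeckij \<Omega> (Suc k) \<theta> = {u \<in> Lp 2 (lebesgue_on \<Omega>).
     \<forall>i. \<exists>w \<in> slobodeckij \<Omega> k \<theta>. has_weak_partial \<Omega> i u w}"

definition sobolev :: "plane set \<Rightarrow> real \<Rightarrow> (plane \<Rightarrow> real) set" where
  "sobolev \<Omega> t = slobodeckij \<Omega> (nat \<lfloor>t\<rfloor>) (frac t)"

section \<open>Lipschitz boundary, traces and boundary Sobolev spaces\<close>

definition lipschitz_boundary :: "plane set \<Rightarrow> bool" where
  "lipschitz_boundary \<Omega> \<longleftrightarrow>
     (\<forall>z\<in>frontier \<Omega>. \<exists>e1 e2 \<gamma> L r h.
        norm e1 = 1 \<and> norm e2 = 1 \<and> e1 \<bullet> e2 = 0 \<and> L-lipschitz_on UNIV (\<gamma> :: real \<Rightarrow> real) \<and>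
        r > 0 \<and> h > 0 \<and>
        (\<forall>x. \<bar>(x - z) \<bullet> e1\<bar> < r \<and> \<bar>(x - z) \<bullet> e2\<bar> < h \<longrightarrow>
             (x \<in> \<Omega> \<longleftrightarrow> (x - z) \<bullet> e2 > \<gamma> ((x - z) \<bullet> e1))))"

text \<open>One-dimensional Hausdorff (outer) measure, which is arc length on Lipschitz curves.\<close>

definition hausdorff1 :: "plane set \<Rightarrow> ennreal" where
  "hausdorff1 A =
     (SUP \<delta>\<in>{0<..}. INF U\<in>{U :: nat \<Rightarrow> plane set. A \<subseteq> (\<Union>n. U n) \<and> (\<forall>n. bounded (U n) \<and> diameter (U n) \<le> \<delta>)}.
        (\<Sum>n. ennreal (diameter (U n))))"

definition boundary_measure :: "plane set \<Rightarrow> plane measure" where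
  "boundary_measure \<Omega> = restrict_space (measure_of UNIV (sets borel) hausdorff1) (frontier \<Omega>)"

text \<open>The trace operator is the closure of the restriction map on smooth functions.\<close>

definition is_trace :: "plane set \<Rightarrow> (plane \<Rightarrow> real) \<Rightarrow> (plane \<Rightarrow> real) \<Rightarrow> bool" where
  "is_trace \<Omega> u g \<longleftrightarrow>
     u \<in> sobolev \<Omega> 1 \<and> g \<in> Lp 2 (boundary_measure \<Omega>) \<and>
     (\<exists>\<phi>. (\<forall>n. smooth (\<phi> n)) \<and>
          L2_converges (lebesgue_on \<Omega>) \<phi> u \<and>
          L2_converges (lebesgue_on \<Omega>) (\<lambda>n x. \<chi> i. partial i (\<phi> n) x) (grad \<Omega> u) \<and>
          L2_converges (boundary_measure \<Omega>) \<phi> g)"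

text \<open>\<open>H\<^sup>t(\<partial>\<Omega>)\<close> for \<open>t \<ge> 1/2\<close> as the trace space of \<open>H\<^bsup>t+1/2\<^esup>(\<Omega>)\<close>; on a Lipschitz
  boundary there is no intrinsic definition for \<open>t > 1\<close>.\<close>

definition boundary_sobolev :: "plane set \<Rightarrow> real \<Rightarrow> (plane \<Rightarrow> real) set" where
  "boundary_sobolev \<Omega> t = {g. \<exists>G \<in> sobolev \<Omega> (t + 1/2). is_trace \<Omega> G g}"

section \<open>Forward problem\<close>

definition weak_solution :: "plane set \<Rightarrow> (plane \<Rightarrow> real) \<Rightarrow> (plane \<Rightarrow> real) \<Rightarrow> (plane \<Rightarrow> real) \<Rightarrow> bool" where
  "weak_solution \<Omega> \<sigma> g u \<longleftrightarrow>
     u \<in> sobolev \<Omega> 1 \<and> is_trace \<Omega> u g \<and>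
     (\<forall>v. v \<in> sobolev \<Omega> 1 \<and> is_trace \<Omega> v (\<lambda>_. 0) \<longrightarrow>
        (\<integral>x. \<sigma> x * (grad \<Omega> u x \<bullet> grad \<Omega> v x) \<partial>lebesgue_on \<Omega>) = 0)"

definition power_density :: "plane set \<Rightarrow> (plane \<Rightarrow> real) \<Rightarrow> (plane \<Rightarrow> real) \<Rightarrow> (plane \<Rightarrow> real) \<Rightarrow> plane \<Rightarrow> real" where
  "power_density \<Omega> \<sigma> u v x = \<sigma> x * (grad \<Omega> u x \<bullet> grad \<Omega> v x)"

type_synonym data = "nat \<Rightarrow> nat \<Rightarrow> plane \<Rightarrow> real"

definition data_space :: "plane set \<Rightarrow> nat \<Rightarrow> nat \<Rightarrow> data set" where
  "data_space \<Omega> l d = {y. \<forall>i\<in>{1..d}. \<forall>j\<in>{1..d}. y i j \<in> Lp l (lebesgue_on \<Omega>)}"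

definition neg_log_likelihood ::
  "plane set \<Rightarrow> nat \<Rightarrow> nat \<Rightarrow> (nat \<Rightarrow> nat \<Rightarrow> real) \<Rightarrow> (nat \<Rightarrow> nat \<Rightarrow> (plane \<Rightarrow> real) \<Rightarrow> plane \<Rightarrow> real) \<Rightarrow>
   data \<Rightarrow> (plane \<Rightarrow> real) \<Rightarrow> real" where
  "neg_log_likelihood \<Omega> l d \<tau> h y \<sigma> =
     (\<Sum>i=1..d. \<Sum>j=1..d.
        Lp_norm l (lebesgue_on \<Omega>) (\<lambda>x. h i j \<sigma> x - y i j x) ^ l / (real l * \<tau> i j ^ l))"

section \<open>Conductivities and prior\<close>

text \<open>Borel \<open>\<sigma>\<close>-algebra of the \<open>L\<^sup>\<infinity>(\<Omega>)\<close> topology on a set \<open>S\<close> of measurable functions.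
  Functions that agree almost everywhere are not identified but have the same neighbourhoods,
  so this is the pull-back of the Borel \<open>\<sigma>\<close>-algebra on the set of equivalence classes.\<close>

definition Linf_dist :: "plane set \<Rightarrow> (plane \<Rightarrow> real) \<Rightarrow> (plane \<Rightarrow> real) \<Rightarrow> ereal" where
  "Linf_dist \<Omega> \<sigma> \<sigma>' = esssup (lebesgue_on \<Omega>) (\<lambda>x. ereal \<bar>\<sigma> x - \<sigma>' x\<bar>)"

definition Linf_borel :: "plane set \<Rightarrow> (plane \<Rightarrow> real) set \<Rightarrow> (plane \<Rightarrow> real) measure" where
  "Linf_borel \<Omega> S =
     sigma S {U. U \<subseteq> S \<and> (\<forall>\<sigma>\<in>U. \<exists>\<epsilon>>0. \<forall>\<sigma>'\<in>S. Linf_dist \<Omega> \<sigma> \<sigma>' < ereal \<epsilon> \<longrightarrow> \<sigma>' \<in> U)}"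

definition conductivity_map :: "nat \<Rightarrow> real \<Rightarrow> real \<Rightarrow> real \<Rightarrow> real \<Rightarrow> real" where
  "conductivity_map p sm sp a t =
     (if p = 1 then exp t
      else if p = 2 then sm + (sp - sm) * indicator {0..} t
      else sm + (sp - sm) * (1 / (1 + exp (- a * t))))"

text \<open>A Hilbert space of (classes of) measurable functions on \<open>\<Omega>\<close>, such as \<open>L\<^sup>2(\<Omega>)\<close> or
  \<open>H\<^sup>k(\<Omega>)\<close>: the abstract Hilbert space is a type, and \<open>J\<close> picks for each of its elements a
  function representing it.\<close>

definition function_space :: "plane set \<Rightarrow> ('h::{real_inner,complete_space} \<Rightarrow> plane \<Rightarrow> real) \<Rightarrow> bool" where
  "function_space \<Omega> J \<longleftrightarrow>
     (\<forall>f. J f \<in> borel_measurable (lebesgue_on \<Omega>)) \<and>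
     (\<forall>f g. AE x in lebesgue_on \<Omega>. J (f + g) x = J f x + J g x) \<and>
     (\<forall>c f. AE x in lebesgue_on \<Omega>. J (c *\<^sub>R f) x = c * J f x) \<and>
     (\<forall>f. (AE x in lebesgue_on \<Omega>. J f x = 0) \<longrightarrow> f = 0)"

definition orthonormal_basis :: "'h::real_inner set \<Rightarrow> bool" where
  "orthonormal_basis B \<longleftrightarrow>
     pairwise orthogonal B \<and> (\<forall>e\<in>B. norm e = 1) \<and> closure (span B) = UNIV"

definition covariance_operator :: "('h::{real_inner,complete_space} \<Rightarrow> 'h) \<Rightarrow> bool" where
  "covariance_operator C \<longleftrightarrow>
     bounded_linear C \<and> (\<forall>f g. C f \<bullet> g = f \<bullet> C g) \<and> (\<forall>f. C f \<bullet> f \<ge> 0) \<and>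
     (\<exists>B. orthonormal_basis B \<and> (\<lambda>e. C e \<bullet> e) summable_on B)"

definition centred_gaussian ::
  "'w measure \<Rightarrow> ('h::{real_inner,complete_space} \<Rightarrow> 'h) \<Rightarrow> ('w \<Rightarrow> 'h) \<Rightarrow> bool" where
  "centred_gaussian M C X \<longleftrightarrow>
     prob_space M \<and> X \<in> borel_measurable M \<and>
     (\<forall>f. if C f \<bullet> f = 0 then (AE \<omega> in M. X \<omega> \<bullet> f = 0)
          else distributed M lborel (\<lambda>\<omega>. X \<omega> \<bullet> f) (\<lambda>t. ennreal (normal_density 0 (sqrt (C f \<bullet> f)) t)))"

section \<open>Posterior and Hellinger distance\<close>

text \<open>Bayes' rule for a fixed observation, \<open>L\<close> being the likelihood of that observation as a
  function of the parameter. A factor of \<open>L\<close> not depending on the parameter cancels.\<close>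

definition posterior :: "'a measure \<Rightarrow> ('a \<Rightarrow> real) \<Rightarrow> 'a measure" where
  "posterior P L =
     measure_of (space P) (sets P)
       (\<lambda>A. (\<integral>\<^sup>+\<sigma>\<in>A. ennreal (L \<sigma>) \<partial>P) / (\<integral>\<^sup>+\<sigma>. ennreal (L \<sigma>) \<partial>P))"

text \<open>The joint law of parameter and data when the parameter has law \<open>P\<close> and, given the
  parameter \<open>\<sigma>\<close>, the data have density \<open>L \<sigma>\<close> with respect to \<open>Q\<close>.\<close>

definition joint_law :: "'a measure \<Rightarrow> 'b measure \<Rightarrow> ('a \<Rightarrow> 'b \<Rightarrow> real) \<Rightarrow> ('a \<times> 'b) measure" where
  "joint_law P Q L = density (P \<Otimes>\<^sub>M Q) (\<lambda>(\<sigma>, y). ennreal (L \<sigma> y))"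

text \<open>\<open>\<kappa>\<close> is a regular conditional distribution, under \<open>\<nu>\<close> on \<open>A \<Otimes>\<^sub>M B\<close>, of the first
  component given the second.\<close>

definition regular_conditional_distribution ::
  "'a measure \<Rightarrow> 'b measure \<Rightarrow> ('a \<times> 'b) measure \<Rightarrow> ('b \<Rightarrow> 'a measure) \<Rightarrow> bool" where
  "regular_conditional_distribution A B \<nu> \<kappa> \<longleftrightarrow>
     (\<forall>y\<in>space B. prob_space (\<kappa> y) \<and> sets (\<kappa> y) = sets A) \<and>
     (\<forall>E\<in>sets A. (\<lambda>y. emeasure (\<kappa> y) E) \<in> borel_measurable B) \<and>
     (\<forall>E\<in>sets A. \<forall>F\<in>sets B.
        emeasure \<nu> (E \<times> F) = (\<integral>\<^sup>+y\<in>F. emeasure (\<kappa> y) E \<partial>distr \<nu> B snd))"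

text \<open>The value does not depend on the dominating measure; \<open>P + Q\<close> is used here.\<close>

definition hellinger :: "'a measure \<Rightarrow> 'a measure \<Rightarrow> real" where
  "hellinger P Q =
     (let \<nu> = measure_of (space P) (sets P) (\<lambda>A. emeasure P A + emeasure Q A)
      in sqrt (1 / 2 * (\<integral>\<sigma>. (sqrt (enn2real (RN_deriv \<nu> P \<sigma>)) - sqrt (enn2real (RN_deriv \<nu> Q \<sigma>)))\<^sup>2 \<partial>\<nu>)))"

end

theory Submission
  imports Defs
begin

text \<open>The likelihood \<open>exp (- \<Phi> y \<sigma>)\<close> takes values in \<open>(0, 1]\<close>. Hence, once \<open>\<sigma> \<mapsto> \<Phi> y \<sigma>\<close> is known to be
  Borel measurable on \<open>S\<close>, the normalising constant is a positive real, Bayes' formula yields a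
  density, and the conditional distribution property is Tonelli's theorem
  (\<open>posterior_as_density\<close>, \<open>posterior_regular_conditional_distribution\<close>). Two points remain.

  \<^bold>\<open>Measurability.\<close> The difference of the solutions for two conductivities \<open>\<sigma>\<close>, \<open>\<rho>\<close> with the same
  boundary data has zero trace, so it may be used as a test function in both equations; this
  gives \<open>\<parallel>\<nabla>(u \<sigma> - u \<rho>)\<parallel> \<le> (\<parallel>\<sigma> - \<rho>\<parallel>\<^sub>\<infinity> / \<sigma>\<^sub>m\<^sub>i\<^sub>n) \<parallel>\<nabla>(u \<sigma>)\<parallel>\<close> in \<open>L\<^sup>2\<close> (\<open>weak_solution_stability\<close>). If
  \<open>\<sigma>\<^sub>n \<rightarrow> \<sigma>\<close> uniformly, the gradients therefore converge in \<open>L\<^sup>2\<close>, the power densities converge almost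
  everywhere along a subsequence, and Fatou's lemma shows that \<open>\<parallel>h \<sigma> - y\<parallel>\<close> is lower semicontinuous
  in \<open>\<sigma>\<close>, for the \<open>L\<^sup>1\<close> and the \<open>L\<^sup>2\<close> norm alike (\<open>power_density_lsc\<close>). Lower semicontinuous
  functions are Borel. For \<open>l = 2\<close> this avoids the question whether \<open>h\<close> is continuous into \<open>L\<^sup>2\<close>.

  Zero trace of the difference includes an assertion about its gradient, which is a representative
  chosen independently of those of the two solutions. So weak derivatives have to be unique almost
  everywhere: a square integrable function orthogonal to all test functions vanishes
  (\<open>L2_eq_0_if_test_functions\<close>). This rests on explicit smooth bumps built from \<open>exp (- 1 / t)\<close>,
  whose limits are indicator functions of boxes.

  \<^bold>\<open>Stability in the data.\<close> For measures given by densities the Hellinger distance is, up to a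
  factor, the \<open>L\<^sup>2\<close> distance of the square roots of the densities (\<open>hellinger_density\<close>). The root
  \<open>exp (- \<Phi> y \<sigma> / 2)\<close> of the likelihood is a product of factors \<open>\<psi> (\<parallel>h\<^sub>i\<^sub>j \<sigma> - y\<^sub>i\<^sub>j\<parallel> / \<tau>\<^sub>i\<^sub>j)\<close>, where
  \<open>\<psi> s = exp (- s\<^sup>l / (2 l))\<close> is bounded by 1 and 1-Lipschitz on \<open>[0, \<infinity>)\<close>. With Minkowski's
  inequality it follows that the root likelihood is globally Lipschitz in \<open>y\<close>, uniformly in \<open>\<sigma>\<close>, even
  if \<open>\<parallel>h\<^sub>i\<^sub>j \<sigma>\<parallel>\<close> is unbounded over \<open>S\<close> (\<open>root_likelihood_Lipschitz\<close>). The radius \<open>r\<close> enters only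
  through the normalising constants: for data in the ball of radius \<open>r\<close> they are bounded below by
  \<open>\<integral> exp (- B \<sigma>) dP > 0\<close>, where \<open>B \<sigma>\<close> is the sum of the \<open>(\<parallel>h\<^sub>i\<^sub>j \<sigma>\<parallel> + r)\<^sup>l / (l \<tau>\<^sub>i\<^sub>j\<^sup>l)\<close>
  (\<open>neg_log_likelihood_le\<close>).\<close>

section \<open>Minkowski's inequality\<close>

text \<open>Convexity of \<open>t \<mapsto> t\<^sup>p\<close>, applied to \<open>a / A\<close> and
  \<open>b / B\<close> with the weights \<open>A / (A + B)\<close> and \<open>B / (A +
  B)\<close>.\<close>

lemma power_add_le_weighted:
  fixes a b A B :: real
  assumes "0 \<le> a" "0 \<le> b" "0 < A" "0 < B" "p \<ge> 1"
  shows "(a + b) ^ p \<le> (A + B) ^ (p - 1) * (a ^ p / A ^ (p - 1) + b ^ p / B ^ (p - 1))"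
proof -
  obtain q where q: "p = Suc q"
    using \<open>p \<ge> 1\<close> by (cases p) auto
  define t where "t = B / (A + B)"
  have t: "0 \<le> t" "t \<le> 1" "1 - t = A / (A + B)"
    using assms by (auto simp: t_def field_simps)
  have "convex_on {0::real..} (\<lambda>x. x ^ p)"
    using convex_power_odd[of p] convex_on_subset[OF convex_power_even[of p], of "{0..}"] by blast
  from convex_onD[OF this t(1,2), of "a / A" "b / B"]
  have "((1 - t) * (a / A) + t * (b / B)) ^ p \<le> (1 - t) * (a / A) ^ p + t * (b / B) ^ p"
    using assms by simp
  also have "(1 - t) * (a / A) + t * (b / B) = (a + b) / (A + B)"
    using assms unfolding t(3) by (simp add: t_def add_divide_distrib)
  also have "(1 - t) * (a / A) ^ p + t * (b / B) ^ p = (a ^ p / A ^ q + b ^ p / B ^ q) / (A + B)"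
  proof -
    have "(1 - t) * (a / A) ^ p = a ^ p / A ^ q / (A + B)"
      using assms unfolding t(3) by (simp add: q power_divide)
    moreover have "t * (b / B) ^ p = b ^ p / B ^ q / (A + B)"
      using assms by (simp add: t_def q power_divide)
    ultimately show ?thesis
      by (simp add: add_divide_distrib)
  qed
  finally have "(a + b) ^ p / (A + B) ^ p \<le> (a ^ p / A ^ q + b ^ p / B ^ q) / (A + B)"
    by (simp add: power_divide)
  then have "(a + b) ^ p \<le> (a ^ p / A ^ q + b ^ p / B ^ q) / (A + B) * (A + B) ^ p"
    using assms by (simp add: pos_divide_le_eq)
  also have "\<dots> = (A + B) ^ q * (a ^ p / A ^ q + b ^ p / B ^ q)"
    using assms by (simp add: q)
  finally show ?thesis
    by (simp add: q)
qed

lemma Lp_add: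
  assumes "p \<ge> 1" "f \<in> Lp p M" "g \<in> Lp p M"
  shows "(\<lambda>x. f x + g x) \<in> Lp p M"
proof -
  have [measurable]: "f \<in> borel_measurable M" "g \<in> borel_measurable M"
    using assms by (auto simp: Lp_def)
  have "integrable M (\<lambda>x. \<bar>f x + g x\<bar> ^ p)"
  proof (rule Bochner_Integration.integrable_bound)
    show "integrable M (\<lambda>x. 2 ^ (p - 1) * (\<bar>f x\<bar> ^ p + \<bar>g x\<bar> ^ p))"
      using assms by (simp add: Lp_def)
    have "\<bar>f x + g x\<bar> ^ p \<le> 2 ^ (p - 1) * (\<bar>f x\<bar> ^ p + \<bar>g x\<bar> ^ p)" for x
      using order_trans[OF power_mono[OF abs_triangle_ineq abs_ge_zero]
        power_add_le_weighted[of "\<bar>f x\<bar>" "\<bar>g x\<bar>" 1 1 p]] \<open>p \<ge> 1\<close> by simp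
    then show "AE x in M. norm (\<bar>f x + g x\<bar> ^ p) \<le> norm (2 ^ (p - 1) * (\<bar>f x\<bar> ^ p + \<bar>g x\<bar> ^ p))"
      by (auto intro!: AE_I2 order_trans[OF _ abs_ge_self])
  qed simp
  then show ?thesis by (simp add: Lp_def)
qed

lemma Lp_minus: "f \<in> Lp p M \<Longrightarrow> (\<lambda>x. - f x) \<in> Lp p M"
  by (auto simp: Lp_def)

lemma Lp_diff: "p \<ge> 1 \<Longrightarrow> f \<in> Lp p M \<Longrightarrow> g \<in> Lp p M \<Longrightarrow> (\<lambda>x. f x - g x) \<in> Lp p M"
  using Lp_add[of p f M "\<lambda>x. - g x"] Lp_minus[of g p M] by simp

lemma Lp_norm_nonneg: "0 \<le> Lp_norm p M f"
  unfolding Lp_norm_def by (cases "p = 0") (auto intro!: real_root_ge_zero)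

lemma Lp_norm_power: "p \<ge> 1 \<Longrightarrow> Lp_norm p M f ^ p = (\<integral>x. \<bar>f x\<bar> ^ p \<partial>M)"
  unfolding Lp_norm_def by (intro real_root_pow_pos2) auto

lemma Lp_norm_minus_commute: "Lp_norm p M (\<lambda>x. f x - g x) = Lp_norm p M (\<lambda>x. g x - f x)"
  by (simp add: Lp_norm_def abs_minus_commute)

text \<open>Integrating the weighted convexity inequality with \<open>A\<close>, \<open>B\<close>
  slightly larger than the two norms bounds the \<open>p\<close>-th power of the left-hand side by
  \<open>(A + B)\<^sup>p\<close>. The surplus \<open>e / 2\<close> keeps the weights positive when a
  norm vanishes.\<close>

lemma Lp_norm_triangle:
  assumes p: "p \<ge> 1" and f: "f \<in> Lp p M" and g: "g \<in> Lp p M"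
  shows "Lp_norm p M (\<lambda>x. f x + g x) \<le> Lp_norm p M f + Lp_norm p M g"
proof (rule field_le_epsilon)
  fix e :: real assume "0 < e"
  let ?I = "\<lambda>f. \<integral>x. \<bar>f x\<bar> ^ p \<partial>M"
  define A where "A = Lp_norm p M f + e / 2"
  define B where "B = Lp_norm p M g + e / 2"
  have AB: "0 < A" "0 < B"
    using \<open>0 < e\<close> Lp_norm_nonneg[of p M f] Lp_norm_nonneg[of p M g] by (auto simp: A_def B_def)
  have frac: "r ^ p / R ^ (p - 1) \<le> R" if "0 \<le> r" "r \<le> R" "0 < R" for r R :: real
  proof -
    have "r ^ p \<le> R * R ^ (p - 1)"
      using power_mono[OF \<open>r \<le> R\<close> \<open>0 \<le> r\<close>, of p] p by (simp flip: power_Suc)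
    then show ?thesis
      using \<open>0 < R\<close> by (simp add: pos_divide_le_eq)
  qed
  have int: "integrable M (\<lambda>x. \<bar>f x\<bar> ^ p)" "integrable M (\<lambda>x. \<bar>g x\<bar> ^ p)" "integrable M (\<lambda>x. \<bar>f x + g x\<bar> ^ p)"
    using f g Lp_add[OF p f g] by (auto simp: Lp_def)
  have "Lp_norm p M (\<lambda>x. f x + g x) ^ p = ?I (\<lambda>x. f x + g x)"
    by (rule Lp_norm_power[OF p])
  also have "\<dots> \<le> (\<integral>x. (A + B) ^ (p - 1) * (\<bar>f x\<bar> ^ p / A ^ (p - 1) + \<bar>g x\<bar> ^ p / B ^ (p - 1)) \<partial>M)"
  proof (rule integral_mono)
    fix x
    have "\<bar>f x + g x\<bar> ^ p \<le> (\<bar>f x\<bar> + \<bar>g x\<bar>) ^ p"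
      by (intro power_mono abs_triangle_ineq) simp
    also have "\<dots> \<le> (A + B) ^ (p - 1) * (\<bar>f x\<bar> ^ p / A ^ (p - 1) + \<bar>g x\<bar> ^ p / B ^ (p - 1))"
      using AB p by (intro power_add_le_weighted) auto
    finally show "\<bar>f x + g x\<bar> ^ p \<le> (A + B) ^ (p - 1) * (\<bar>f x\<bar> ^ p / A ^ (p - 1) + \<bar>g x\<bar> ^ p / B ^ (p - 1))" .
  qed (use int in auto)
  also have "\<dots> = (A + B) ^ (p - 1) * (?I f / A ^ (p - 1) + ?I g / B ^ (p - 1))"
    using int by simp
  also have "\<dots> \<le> (A + B) ^ (p - 1) * (A + B)"
    unfolding Lp_norm_power[OF p, symmetric] using AB \<open>0 < e\<close>
    by (intro mult_left_mono add_mono frac Lp_norm_nonneg) (simp_all add: A_def B_def)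
  also have "\<dots> = (A + B) ^ p"
    using p by (simp flip: power_Suc2)
  finally have "Lp_norm p M (\<lambda>x. f x + g x) ^ Suc (p - 1) \<le> (A + B) ^ Suc (p - 1)"
    using p by simp
  then have "Lp_norm p M (\<lambda>x. f x + g x) \<le> A + B"
    by (rule power_le_imp_le_base) (use AB in auto)
  then show "Lp_norm p M (\<lambda>x. f x + g x) \<le> Lp_norm p M f + Lp_norm p M g + e"
    by (simp add: A_def B_def)
qed

lemma Lp_norm_residual_diff:
  assumes "p \<ge> 1" "f \<in> Lp p M" "g \<in> Lp p M" "k \<in> Lp p M"
  shows "\<bar>Lp_norm p M (\<lambda>x. f x - g x) - Lp_norm p M (\<lambda>x. f x - k x)\<bar> \<le> Lp_norm p M (\<lambda>x. g x - k x)"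
proof -
  have "Lp_norm p M (\<lambda>x. f x - g x) \<le> Lp_norm p M (\<lambda>x. f x - k x) + Lp_norm p M (\<lambda>x. g x - k x)"
    if "g \<in> Lp p M" "k \<in> Lp p M" for g k
    using Lp_norm_triangle[OF assms(1) Lp_diff[OF assms(1,2) that(2)] Lp_diff[OF assms(1) that(2,1)]]
    by (simp add: Lp_norm_minus_commute[of p M g k])
  from this[OF assms(3,4)] this[OF assms(4,3)] show ?thesis
    by (simp add: Lp_norm_minus_commute[of p M k g] abs_le_iff)
qed

section \<open>Smooth bump functions and the fundamental lemma of the calculus of variations\<close>

text \<open>The standard flat function at 0. The polynomial factor makes the family closed under
  differentiation, so that smoothness follows from differentiability of all its members.\<close>

definition exp_flat :: "real poly \<Rightarrow> real \<Rightarrow> real" where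
  "exp_flat p t = (if 0 < t then poly p (1 / t) * exp (- (1 / t)) else 0)"

lemma poly_times_exp_minus_tendsto_0: "((\<lambda>s. poly p s * exp (- s)) \<longlongrightarrow> (0::real)) at_top"
proof -
  have "((\<lambda>s. \<Sum>i\<le>degree p. coeff p i * (s ^ i / exp s)) \<longlongrightarrow> (\<Sum>i\<le>degree p. coeff p i * 0)) at_top"
    by (intro tendsto_intros tendsto_power_div_exp_0)
  moreover have "poly p s * exp (- s) = (\<Sum>i\<le>degree p. coeff p i * (s ^ i / exp s))" for s
    by (simp add: poly_altdef sum_distrib_right sum_divide_distrib exp_minus divide_inverse mult.assoc)
  ultimately show ?thesis by simp
qed

text \<open>With \<open>s = 1 / t\<close> this says that the exponential beats every polynomial.
  Applied to \<open>pCons 0 p\<close>, it also gives the derivative at 0.\<close>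

lemma exp_flat_tendsto_0: "(exp_flat p \<longlongrightarrow> 0) (at 0)"
proof (rule filterlim_split_at)
  have "\<forall>\<^sub>F t in at_left 0. exp_flat p t = 0"
    by (auto simp: eventually_at_filter exp_flat_def)
  then show "(exp_flat p \<longlongrightarrow> 0) (at_left 0)"
    by (simp add: tendsto_eventually)
  have "((\<lambda>t. poly p (inverse t) * exp (- inverse t)) \<longlongrightarrow> 0) (at_right 0)"
    by (rule filterlim_compose[OF poly_times_exp_minus_tendsto_0 filterlim_inverse_at_top_right])
  moreover have "\<forall>\<^sub>F t in at_right 0. poly p (inverse t) * exp (- inverse t) = exp_flat p t"
    by (auto simp: eventually_at_filter exp_flat_def inverse_eq_divide)
  ultimately show "(exp_flat p \<longlongrightarrow> 0) (at_right 0)"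
    by (rule Lim_transform_eventually)
qed

lemma exp_flat_has_derivative:
  "(exp_flat p has_real_derivative exp_flat ([:0, 0, 1:] * (p - pderiv p)) t) (at t)"
proof -
  consider "t < 0" | "t = 0" | "t > 0" by linarith
  then show ?thesis
  proof cases
    case 1
    have "((\<lambda>_. 0) has_real_derivative exp_flat ([:0, 0, 1:] * (p - pderiv p)) t) (at t)"
      using 1 by (simp add: exp_flat_def)
    then show ?thesis
      by (rule has_field_derivative_transform_within_open[where S="{..<0}"])
         (use 1 in \<open>auto simp: exp_flat_def\<close>)
  next
    case 2
    have "((\<lambda>h. exp_flat p h / h) \<longlongrightarrow> 0) (at 0)"
    proof (rule Lim_transform_eventually[OF exp_flat_tendsto_0[of "pCons 0 p"]])
      show "\<forall>\<^sub>F h in at 0. exp_flat (pCons 0 p) h = exp_flat p h / h"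
        by (auto simp: eventually_at_filter exp_flat_def)
    qed
    then show ?thesis
      using 2 by (simp add: DERIV_def exp_flat_def)
  next
    case 3
    have "((\<lambda>s. poly p (1 / s) * exp (- (1 / s))) has_real_derivative
        exp_flat ([:0, 0, 1:] * (p - pderiv p)) t) (at t)"
      using 3
      by (auto intro!: derivative_eq_intros simp: exp_flat_def field_simps power2_eq_square)
    then show ?thesis
      by (rule has_field_derivative_transform_within_open[where S="{0<..}"])
         (use 3 in \<open>auto simp: exp_flat_def\<close>)
  qed
qed

lemma exp_flat_1_bounds: "0 \<le> exp_flat 1 t" "exp_flat 1 t \<le> 1"
  by (auto simp: exp_flat_def)

lemma exp_flat_1_scaled_tendsto: "(\<lambda>n. exp_flat 1 (real n * t)) \<longlonglongrightarrow> indicator {0<..} t"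
proof (cases "t > 0")
  case True
  have "(\<lambda>n. 1 / (real n * t)) \<longlonglongrightarrow> 0"
    using tendsto_mult[OF lim_1_over_n tendsto_const[of "1/t"]] by simp
  then have "(\<lambda>n. exp (- (1 / (real n * t)))) \<longlonglongrightarrow> exp (- 0)"
    by (intro tendsto_intros)
  moreover have "\<forall>\<^sub>F n in sequentially. exp (- (1 / (real n * t))) = exp_flat 1 (real n * t)"
    using True by (intro eventually_sequentiallyI[of 1]) (auto simp: exp_flat_def)
  ultimately show ?thesis
    using True by (auto intro: Lim_transform_eventually)
next
  case False
  then have "exp_flat 1 (real n * t) = 0" for n
    by (auto simp: exp_flat_def zero_less_mult_iff)
  with False show ?thesis by simp
qed

lemma partial_eqI:
  assumes "\<And>x. (f has_derivative f' x) (at x)"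
  shows "partial i f = (\<lambda>x. f' x (axis i 1))"
  unfolding partial_def using frechet_derivative_at[OF assms] by (intro ext) metis

lemma C_k_const: "C_k k (\<lambda>_. c)"
proof (induction k arbitrary: c)
  case (Suc k)
  have "partial i (\<lambda>_. c) = (\<lambda>_. 0)" for i
    by (rule partial_eqI) simp
  with Suc show ?case by simp
qed simp

lemma C_k_mono_Suc: "C_k (Suc k) f \<Longrightarrow> C_k k f"
proof (induction k arbitrary: f)
  case 0
  then show ?case
    by (auto simp: continuous_on_eq_continuous_at differentiable_imp_continuous_within)
qed (metis C_k.simps(2))

lemma partial_add:
  assumes "\<And>x. f differentiable (at x)" "\<And>x. g differentiable (at x)"
  shows "partial i (\<lambda>x. f x + g x) = (\<lambda>x. partial i f x + partial i g x)"
  using partial_eqI[OF has_derivative_add[OF assms(1)[unfolded frechet_derivative_works]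
      assms(2)[unfolded frechet_derivative_works]]]
  by (simp add: partial_def)

lemma partial_minus:
  assumes "\<And>x. f differentiable (at x)" "\<And>x. g differentiable (at x)"
  shows "partial i (\<lambda>x. f x - g x) = (\<lambda>x. partial i f x - partial i g x)"
  using partial_eqI[OF has_derivative_diff[OF assms(1)[unfolded frechet_derivative_works]
      assms(2)[unfolded frechet_derivative_works]]]
  by (simp add: partial_def)

lemma partial_mult:
  assumes "\<And>x. f differentiable (at x)" "\<And>x. g differentiable (at x)"
  shows "partial i (\<lambda>x. f x * g x) = (\<lambda>x. f x * partial i g x + partial i f x * g x)"
  using partial_eqI[OF has_derivative_mult[OF assms(1)[unfolded frechet_derivative_works]
      assms(2)[unfolded frechet_derivative_works]]]
  by (simp add: partial_def)

lemma C_k_add: "C_k k f \<Longrightarrow> C_k k g \<Longrightarrow> C_k k (\<lambda>x. f x + g x)"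
  by (induction k arbitrary: f g) (auto simp: partial_add intro!: continuous_intros)

lemma C_k_minus: "C_k k f \<Longrightarrow> C_k k g \<Longrightarrow> C_k k (\<lambda>x. f x - g x)"
  by (induction k arbitrary: f g) (auto simp: partial_minus intro!: continuous_intros)

lemma C_k_mult: "C_k k f \<Longrightarrow> C_k k g \<Longrightarrow> C_k k (\<lambda>x. f x * g x)"
proof (induction k arbitrary: f g)
  case (Suc k)
  then have "C_k k f" "C_k k g" by (auto dest: C_k_mono_Suc simp del: C_k.simps)
  with Suc show ?case by (auto simp: partial_mult intro!: C_k_add)
qed (auto intro!: continuous_intros)

lemma C_k_prod: "(\<And>i. i \<in> I \<Longrightarrow> C_k k (f i)) \<Longrightarrow> C_k k (\<lambda>x. \<Prod>i\<in>I. f i x)"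
  by (induction I rule: infinite_finite_induct) (auto intro: C_k_mult C_k_const)

text \<open>Every partial derivative is again of the form \<open>c' * exp_flat q (\<alpha> * x $ i
  + \<beta>)\<close>, whence the generality in \<open>c\<close> and \<open>p\<close>.\<close>

lemma C_k_exp_flat_coordinate: "C_k k (\<lambda>x. c * exp_flat p (\<alpha> * x $ i + \<beta>))"
proof (induction k arbitrary: c p)
  have deriv: "((\<lambda>x. c * exp_flat p (\<alpha> * x $ i + \<beta>)) has_derivative
      (\<lambda>v. c * (exp_flat ([:0, 0, 1:] * (p - pderiv p)) (\<alpha> * x $ i + \<beta>) * (\<alpha> * v $ i)))) (at x)"
    for c p and x :: plane
  proof -
    have "((\<lambda>x::plane. \<alpha> * x $ i + \<beta>) has_derivative (\<lambda>v. \<alpha> * v $ i)) (at x)"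
      by (auto intro!: derivative_eq_intros bounded_linear.has_derivative[OF bounded_linear_vec_nth])
    from has_derivative_compose[OF this has_field_derivative_imp_has_derivative[OF exp_flat_has_derivative]]
    show ?thesis by (intro has_derivative_mult_right)
  qed
  {
    case 0
    show ?case
      using deriv[of c p] by (auto simp: continuous_on_eq_continuous_at intro: has_derivative_continuous)
  next
    case (Suc k)
    have "partial j (\<lambda>x. c * exp_flat p (\<alpha> * x $ i + \<beta>)) =
        (\<lambda>x. (c * (\<alpha> * axis j 1 $ i)) * exp_flat ([:0, 0, 1:] * (p - pderiv p)) (\<alpha> * x $ i + \<beta>))" for j
      using partial_eqI[OF deriv] by (simp add: algebra_simps)
    moreover have "(\<lambda>x. c * exp_flat p (\<alpha> * x $ i + \<beta>)) differentiable (at x)" for x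
      unfolding differentiable_def using deriv by blast
    ultimately show ?case
      using Suc by simp
  }
qed

text \<open>For every \<open>n\<close> the support lies in \<open>cbox a b\<close>. Stretching by
  \<open>n\<close> pushes each factor, hence the product, to 1 at every interior point.\<close>

definition box_bump :: "nat \<Rightarrow> plane \<Rightarrow> plane \<Rightarrow> plane \<Rightarrow> real" where
  "box_bump n a b x =
     (\<Prod>i\<in>UNIV. exp_flat 1 (real n * (x $ i - a $ i)) * exp_flat 1 (real n * (b $ i - x $ i)))"

lemma smooth_box_bump: "smooth (box_bump n a b)"
proof -
  have "C_k k (\<lambda>x. exp_flat 1 (real n * (x $ i - a $ i)))" for k i
    using C_k_exp_flat_coordinate[of k 1 1 "real n" i "- real n * a $ i"] by (simp add: algebra_simps)
  moreover have "C_k k (\<lambda>x. exp_flat 1 (real n * (b $ i - x $ i)))" for k i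
    using C_k_exp_flat_coordinate[of k 1 1 "- real n" i "real n * b $ i"] by (simp add: algebra_simps)
  ultimately show ?thesis
    unfolding smooth_def box_bump_def by (intro allI C_k_prod C_k_mult)
qed

lemma box_bump_bounds: "0 \<le> box_bump n a b x" "box_bump n a b x \<le> 1"
  unfolding box_bump_def by (auto intro!: prod_nonneg prod_le_1 mult_le_one simp: exp_flat_1_bounds)

lemma box_bump_tendsto: "(\<lambda>n. box_bump n a b x) \<longlonglongrightarrow> indicator (box a b) x"
proof -
  have "(\<lambda>n. box_bump n a b x) \<longlonglongrightarrow> (\<Prod>i\<in>UNIV. indicator {0<..} (x $ i - a $ i) * indicator {0<..} (b $ i - x $ i))"
    unfolding box_bump_def by (intro tendsto_intros exp_flat_1_scaled_tendsto)
  also have "(\<Prod>i\<in>UNIV. indicator {0<..} (x $ i - a $ i) * indicator {0<..} (b $ i - x $ i)) = (indicator (box a b) x :: real)"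
    by (auto simp: mem_box_cart indicator_def intro!: prod.neutral prod_zero)
  finally show ?thesis .
qed

lemma test_function_box_bump:
  assumes "cbox a b \<subseteq> \<Omega>"
  shows "test_function \<Omega> (box_bump n a b)"
proof -
  have "box_bump n a b x = 0" if x: "x \<notin> cbox a b" for x
  proof -
    from x have "\<exists>i. x $ i < a $ i \<or> b $ i < x $ i"
      by (auto simp: mem_box_cart not_le)
    then obtain i where "x $ i < a $ i \<or> b $ i < x $ i" ..
    then have "exp_flat 1 (real n * (x $ i - a $ i)) * exp_flat 1 (real n * (b $ i - x $ i)) = 0"
      by (auto simp: exp_flat_def zero_less_mult_iff)
    then show ?thesis
      unfolding box_bump_def by (intro prod_zero) auto
  qed
  with assms show ?thesis
    unfolding test_function_def by (metis smooth_box_bump compact_cbox)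
qed

lemma smooth_continuous: "smooth f \<Longrightarrow> continuous_on UNIV f"
  unfolding smooth_def by (metis C_k.simps(1))

lemma smooth_differentiable: "smooth f \<Longrightarrow> f differentiable (at x)"
  unfolding smooth_def by (metis C_k.simps(2))

lemma smooth_partial: "smooth f \<Longrightarrow> smooth (partial i f)"
  unfolding smooth_def by (metis C_k.simps(2))

lemma smooth_minus: "smooth f \<Longrightarrow> smooth g \<Longrightarrow> smooth (\<lambda>x. f x - g x)"
  unfolding smooth_def by (blast intro: C_k_minus)

text \<open>The bumps are bounded by 1 and converge to the indicator function of the box, so
  dominated convergence applies.\<close>

lemma integral_box_eq_0:
  fixes w :: "plane \<Rightarrow> real"
  assumes w: "integrable lborel w"
    and test: "\<And>\<phi>. test_function \<Omega> \<phi> \<Longrightarrow> (\<integral>x. w x * \<phi> x \<partial>lborel) = 0"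
    and "cbox a b \<subseteq> \<Omega>"
  shows "(LINT x:box a b|lborel. w x) = 0"
proof -
  have [measurable]: "box_bump n a b \<in> borel_measurable borel" for n
    by (intro borel_measurable_continuous_onI smooth_continuous smooth_box_bump)
  have "(\<lambda>n. \<integral>x. w x * box_bump n a b x \<partial>lborel) \<longlonglongrightarrow> (\<integral>x. w x * indicator (box a b) x \<partial>lborel)"
  proof (rule integral_dominated_convergence)
    show "integrable lborel (\<lambda>x. norm (w x))"
      using w by simp
    show "AE x in lborel. (\<lambda>n. w x * box_bump n a b x) \<longlonglongrightarrow> w x * indicator (box a b) x"
      by (intro AE_I2 tendsto_intros box_bump_tendsto)
    show "AE x in lborel. norm (w x * box_bump n a b x) \<le> norm (w x)" for n
      using box_bump_bounds by (auto simp: abs_mult intro!: mult_left_le)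
  qed (use w in auto)
  then show ?thesis
    using test[OF test_function_box_bump[OF assms(3)]]
    by (simp add: LIMSEQ_const_iff set_lebesgue_integral_def mult.commute)
qed

text \<open>Boxes are stable under intersection and generate the Borel sets. The complement
  step of the Dynkin argument works because the integral over the fixed box itself vanishes.\<close>

lemma set_integral_box_borel_eq_0:
  fixes w :: "plane \<Rightarrow> real"
  assumes w: "integrable lborel w"
    and test: "\<And>\<phi>. test_function \<Omega> \<phi> \<Longrightarrow> (\<integral>x. w x * \<phi> x \<partial>lborel) = 0"
    and sub: "cbox a b \<subseteq> \<Omega>"
    and "A \<in> sets borel"
  shows "(LINT x:A \<inter> box a b|lborel. w x) = 0"
proof -
  have int: "set_integrable lborel B w" if "B \<in> sets borel" for B
    using integrable_mult_indicator[of B lborel w] w that unfolding set_integrable_def by simp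
  have borel: "sets borel = sigma_sets UNIV (range (\<lambda>(a, b). box a b :: plane set))"
    by (subst borel_eq_box) simp
  have stable: "Int_stable (range (\<lambda>(a, b). box a b :: plane set))"
    unfolding Int_stable_def
  proof safe
    fix a b c d :: plane
    from box_Int_box[of a b c d] obtain a' b' where "box a b \<inter> box c d = box a' b'"
      by blast
    then show "box a b \<inter> box c d \<in> range (\<lambda>(a, b). box a b)"
      by auto
  qed
  have A: "A \<in> sigma_sets UNIV (range (\<lambda>(a, b). box a b))"
    using assms(4) borel by simp
  have "range (\<lambda>(a, b). box a b :: plane set) \<subseteq> Pow UNIV"
    by simp
  from stable this A show ?thesis
  proof (induction A rule: sigma_sets_induct_disjoint)
    case (basic A)
    then obtain c d where "A = box c d" by auto
    with box_Int_box[of c d a b] obtain c' d' where eq: "A \<inter> box a b = box c' d'"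
      by blast
    show ?case
    proof (cases "box c' d' = {}")
      case True
      then show ?thesis unfolding eq by (simp add: set_lebesgue_integral_def)
    next
      case False
      \<comment> \<open>a nonempty open box determines the closed one as its closure\<close>
      then have "cbox c' d' = closure (A \<inter> box a b)"
        unfolding eq by (simp add: closure_box)
      also have "\<dots> \<subseteq> cbox a b"
        by (intro closure_minimal) (auto intro: box_subset_cbox[THEN subsetD])
      finally show ?thesis
        unfolding eq using integral_box_eq_0[OF w test] sub by (meson order_trans)
    qed
  next
    case empty
    then show ?case by (simp add: set_lebesgue_integral_def)
  next
    case (compl A)
    then have [measurable]: "A \<in> sets borel" using borel by simp
    have "(LINT x:box a b|lborel. w x) =
        (LINT x:A \<inter> box a b|lborel. w x) + (LINT x:(UNIV - A) \<inter> box a b|lborel. w x)"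
      by (subst set_integral_Un[symmetric]) (auto intro!: int arg_cong2[where f="set_lebesgue_integral lborel"])
    then show ?case
      using integral_box_eq_0[OF w test sub] compl by simp
  next
    case (union A)
    then have [measurable]: "A i \<in> sets borel" for i using borel by auto
    have "(LINT x:(\<Union>i. A i \<inter> box a b)|lborel. w x) = (\<Sum>i. LINT x:A i \<inter> box a b|lborel. w x)"
      using \<open>disjoint_family A\<close>
      by (intro lebesgue_integral_countable_add int)
         (auto simp: disjoint_family_on_def)
    then show ?case using union by (simp add: Int_UN_distrib2)
  qed
qed

text \<open>On a box the integrals of \<open>w\<close> over \<open>{w > 0}\<close> and \<open>{w <
  0}\<close> vanish, so \<open>w\<close> does. Countably many boxes cover
  \<open>\<Omega>\<close>.\<close>

lemma AE_eq_0_if_test_functions: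
  fixes w :: "plane \<Rightarrow> real"
  assumes w: "integrable lborel w" and "open \<Omega>"
    and test: "\<And>\<phi>. test_function \<Omega> \<phi> \<Longrightarrow> (\<integral>x. w x * \<phi> x \<partial>lborel) = 0"
  shows "AE x in lborel. x \<in> \<Omega> \<longrightarrow> w x = 0"
proof -
  have [measurable]: "w \<in> borel_measurable borel"
    using borel_measurable_integrable[OF w] by simp
  have nonpos: "AE x in lborel. x \<in> cbox a b \<longrightarrow> s * w x \<le> 0"
    if "cbox a b \<subseteq> \<Omega>" for a b s
  proof -
    \<comment> \<open>the sign \<open>s = 1\<close> or \<open>s = -1\<close> selects the positive or the negative part of \<open>w\<close>\<close>
    let ?f = "\<lambda>x. indicator ({x. s * w x > 0} \<inter> box a b) x * (s * w x)"
    have "(\<integral>x. ?f x \<partial>lborel) = s * (LINT x:{x. s * w x > 0} \<inter> box a b|lborel. w x)"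
      unfolding set_lebesgue_integral_def by (simp flip: integral_mult_right_zero add: ac_simps)
    also have "\<dots> = 0"
      using set_integral_box_borel_eq_0[OF w test that, of "{x. s * w x > 0}"] by simp
    finally have "AE x in lborel. ?f x = 0"
      using integrable_mult_indicator[of "{x. s * w x > 0} \<inter> box a b" lborel "\<lambda>x. s * w x"] w
      by (subst (asm) integral_nonneg_eq_0_iff_AE) (auto simp: indicator_def)
    moreover have "AE x in lborel. x \<notin> cbox a b - box a b"
      using negligible_frontier_interval[of a b]
      by (intro AE_not_in) (auto simp: negligible_iff_null_sets null_sets_completion_iff)
    ultimately show ?thesis
      by eventually_elim (auto simp: indicator_def split: if_splits)
  qed
  define I where "I = {f \<in> (Basis::plane set) \<rightarrow>\<^sub>E \<rat> \<times> \<rat>.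
    cbox (\<Sum>i\<in>Basis. fst (f i) *\<^sub>R i) (\<Sum>i\<in>Basis. snd (f i) *\<^sub>R i) \<subseteq> \<Omega>}"
  have "countable I"
    unfolding I_def by (intro countable_Collect countable_PiE) (auto intro: countable_rat)
  moreover have "AE x in lborel. x \<in> cbox (\<Sum>i\<in>Basis. fst (f i) *\<^sub>R i) (\<Sum>i\<in>Basis. snd (f i) *\<^sub>R i) \<longrightarrow> w x = 0"
    if "f \<in> I" for f
  proof -
    let ?B = "cbox (\<Sum>i\<in>Basis. fst (f i) *\<^sub>R i) (\<Sum>i\<in>Basis. snd (f i) *\<^sub>R i)"
    have "?B \<subseteq> \<Omega>"
      using that by (simp add: I_def)
    from nonpos[OF this, of 1] nonpos[OF this, of "-1"] show ?thesis
      by eventually_elim (simp add: order_antisym)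
  qed
  ultimately have "AE x in lborel. \<forall>f\<in>I. x \<in> cbox (\<Sum>i\<in>Basis. fst (f i) *\<^sub>R i) (\<Sum>i\<in>Basis. snd (f i) *\<^sub>R i) \<longrightarrow> w x = 0"
    by (subst AE_ball_countable) auto
  moreover have "\<Omega> = (\<Union>f\<in>I. cbox (\<Sum>i\<in>Basis. fst (f i) *\<^sub>R i) (\<Sum>i\<in>Basis. snd (f i) *\<^sub>R i))"
    unfolding I_def by (rule open_UNION_cbox[OF \<open>open \<Omega>\<close>])
  ultimately show ?thesis
    by (auto elim!: eventually_mono)
qed

section \<open>Weak gradients and traces of differences\<close>

lemma L2_D:
  assumes "f \<in> Lp 2 M"
  shows "f \<in> borel_measurable M" "integrable M (\<lambda>x. (f x)\<^sup>2)"
  using assms by (auto simp: Lp_def)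

lemma L2_diff: "f \<in> Lp 2 M \<Longrightarrow> g \<in> Lp 2 M \<Longrightarrow> (\<lambda>x. f x - g x) \<in> Lp 2 M"
  by (rule Lp_diff) simp_all

lemma L2_integrable:
  assumes "f \<in> Lp 2 M" "finite_measure M"
  shows "integrable M f"
  using L2_D[OF assms(1)] finite_measure.square_integrable_imp_integrable[OF assms(2)] by blast

lemma finite_lebesgue_on:
  assumes "open \<Omega>" "bounded \<Omega>"
  shows "finite_measure (lebesgue_on \<Omega> :: plane measure)"
proof -
  have "\<Omega> \<in> lmeasurable"
    using assms by (intro bounded_set_imp_lmeasurable) auto
  then show ?thesis
    by (auto intro!: finite_measureI simp: emeasure_restrict_space fmeasurable_def)
qed

lemma test_function_partial:
  assumes "test_function \<Omega> \<phi>"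
  shows "test_function \<Omega> (partial i \<phi>)"
proof -
  obtain K where K: "compact K" "K \<subseteq> \<Omega>" "\<And>x. x \<notin> K \<Longrightarrow> \<phi> x = 0"
    using assms by (auto simp: test_function_def)
  have "partial i \<phi> x = 0" if "x \<notin> K" for x
  proof -
    have "(\<phi> has_derivative (\<lambda>_. 0)) (at x)"
    proof (rule has_derivative_transform_within_open)
      show "((\<lambda>_. 0) has_derivative (\<lambda>_. 0)) (at x)" by simp
      show "open (- K)" using K(1) by (simp add: compact_imp_closed open_Compl)
    qed (use K that in auto)
    from frechet_derivative_at[OF this, symmetric] show ?thesis
      by (simp add: partial_def)
  qed
  with K assms show ?thesis
    unfolding test_function_def by (auto intro: smooth_partial)
qed

lemma test_function_bounded:
  assumes "test_function \<Omega> \<phi>"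
  obtains B where "\<And>x. \<bar>\<phi> x\<bar> \<le> B"
proof -
  obtain K where K: "compact K" "\<And>x. x \<notin> K \<Longrightarrow> \<phi> x = 0" and "smooth \<phi>"
    using assms by (auto simp: test_function_def)
  have "bounded (\<phi> ` K)"
    using compact_continuous_image[OF continuous_on_subset[OF smooth_continuous[OF \<open>smooth \<phi>\<close>]] K(1)]
    by (simp add: compact_imp_bounded)
  then obtain B where "\<And>x. x \<in> K \<Longrightarrow> \<bar>\<phi> x\<bar> \<le> B"
    by (auto simp: bounded_iff)
  then have "\<bar>\<phi> x\<bar> \<le> max B 0" for x
    using K(2)[of x] by (cases "x \<in> K") (auto simp: le_max_iff_disj)
  then show ?thesis by (rule that)
qed

lemma smooth_lebesgue_measurable:
  "open \<Omega> \<Longrightarrow> smooth \<phi> \<Longrightarrow> \<phi> \<in> borel_measurable (lebesgue_on \<Omega>)"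
  by (intro continuous_imp_measurable_on_sets_lebesgue continuous_on_subset[OF smooth_continuous]) auto

lemma L2_test_integrable:
  assumes "open \<Omega>" "bounded \<Omega>" "f \<in> Lp 2 (lebesgue_on \<Omega>)" "test_function \<Omega> \<phi>"
  shows "integrable (lebesgue_on \<Omega>) (\<lambda>x. f x * \<phi> x)"
proof -
  obtain B where B: "\<And>x. \<bar>\<phi> x\<bar> \<le> B"
    using test_function_bounded[OF assms(4)] by blast
  have "smooth \<phi>" using assms(4) by (simp add: test_function_def)
  note [measurable] = L2_D(1)[OF assms(3)] smooth_lebesgue_measurable[OF assms(1) this]
  show ?thesis
  proof (rule Bochner_Integration.integrable_bound)
    show "integrable (lebesgue_on \<Omega>) (\<lambda>x. B * f x)"
      using L2_integrable[OF assms(3) finite_lebesgue_on[OF assms(1,2)]] by simp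
    have "\<bar>f x * \<phi> x\<bar> \<le> \<bar>B * f x\<bar>" for x
      using mult_right_mono[OF order_trans[OF B[of x] abs_ge_self] abs_ge_zero[of "f x"]]
      by (simp add: abs_mult ac_simps)
    then show "AE x in lebesgue_on \<Omega>. norm (f x * \<phi> x) \<le> norm (B * f x)"
      by simp
  qed simp
qed

lemma has_weak_partial_diff:
  assumes "open \<Omega>" "bounded \<Omega>" "has_weak_partial \<Omega> i u w" "has_weak_partial \<Omega> i v z"
  shows "has_weak_partial \<Omega> i (\<lambda>x. u x - v x) (\<lambda>x. w x - z x)"
  unfolding has_weak_partial_def
proof (intro conjI allI impI)
  fix \<phi> assume \<phi>: "test_function \<Omega> \<phi>"
  have L2: "u \<in> Lp 2 (lebesgue_on \<Omega>)" "v \<in> Lp 2 (lebesgue_on \<Omega>)"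
      "w \<in> Lp 2 (lebesgue_on \<Omega>)" "z \<in> Lp 2 (lebesgue_on \<Omega>)"
    using assms(3,4) by (auto simp: has_weak_partial_def)
  note int = L2_test_integrable[OF assms(1,2)]
  note \<phi>' = test_function_partial[OF \<phi>]
  have "(\<integral>x. (u x - v x) * partial i \<phi> x \<partial>lebesgue_on \<Omega>) =
      (\<integral>x. u x * partial i \<phi> x \<partial>lebesgue_on \<Omega>) - (\<integral>x. v x * partial i \<phi> x \<partial>lebesgue_on \<Omega>)"
    using int[OF L2(1) \<phi>'] int[OF L2(2) \<phi>'] by (simp add: left_diff_distrib)
  also have "\<dots> = - ((\<integral>x. w x * \<phi> x \<partial>lebesgue_on \<Omega>) - (\<integral>x. z x * \<phi> x \<partial>lebesgue_on \<Omega>))"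
    using assms(3,4) \<phi> by (simp add: has_weak_partial_def)
  also have "\<dots> = - (\<integral>x. (w x - z x) * \<phi> x \<partial>lebesgue_on \<Omega>)"
    using int[OF L2(3) \<phi>] int[OF L2(4) \<phi>] by (simp add: left_diff_distrib)
  finally show "(\<integral>x. (u x - v x) * partial i \<phi> x \<partial>lebesgue_on \<Omega>) =
      - (\<integral>x. (w x - z x) * \<phi> x \<partial>lebesgue_on \<Omega>)" .
qed (use assms(3,4) in \<open>auto simp: has_weak_partial_def intro: L2_diff\<close>)

text \<open>The fundamental lemma of the calculus of variations. The function is extended by zero
  to the plane and replaced by a Borel measurable representative.\<close>

lemma L2_eq_0_if_test_functions:
  assumes "open \<Omega>" "bounded \<Omega>" "f \<in> Lp 2 (lebesgue_on \<Omega>)"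
    and test: "\<And>\<phi>. test_function \<Omega> \<phi> \<Longrightarrow> (\<integral>x. f x * \<phi> x \<partial>lebesgue_on \<Omega>) = 0"
  shows "AE x in lebesgue_on \<Omega>. f x = 0"
proof -
  have [simp]: "\<Omega> \<in> sets lebesgue"
    using assms(1) by auto
  let ?f = "\<lambda>x. indicator \<Omega> x *\<^sub>R f x"
  have int_f: "integrable lebesgue ?f"
    using L2_integrable[OF assms(3) finite_lebesgue_on[OF assms(1,2)]]
      integrable_restrict_space[of \<Omega> lebesgue f] by simp
  from completion_ex_borel_measurable_real[OF borel_measurable_integrable[OF this]]
  obtain w where [measurable]: "w \<in> borel_measurable lborel"
    and w: "AE x in lborel. ?f x = w x"
    by blast
  have "integrable lebesgue w"
    by (rule integrable_cong_AE_imp[OF int_f measurable_completion])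
       (use AE_completion[OF w] in simp_all)
  then have int: "integrable lborel w"
    by (simp add: integrable_completion)
  have "(\<integral>x. w x * \<phi> x \<partial>lborel) = 0" if \<phi>: "test_function \<Omega> \<phi>" for \<phi>
  proof -
    have [measurable]: "\<phi> \<in> borel_measurable borel"
      using \<phi> by (intro borel_measurable_continuous_onI smooth_continuous) (simp add: test_function_def)
    have "(\<integral>x. w x * \<phi> x \<partial>lborel) = (\<integral>x. w x * \<phi> x \<partial>lebesgue)"
      by (simp add: integral_completion)
    also have "\<dots> = (\<integral>x. indicator \<Omega> x *\<^sub>R (f x * \<phi> x) \<partial>lebesgue)"
    proof (rule integral_cong_AE)
      have "\<phi> \<in> borel_measurable lebesgue"
        by (rule measurable_completion) simp
      then have "(\<lambda>x. ?f x * \<phi> x) \<in> borel_measurable lebesgue"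
        using borel_measurable_integrable[OF int_f] by measurable
      then show "(\<lambda>x. indicator \<Omega> x *\<^sub>R (f x * \<phi> x)) \<in> borel_measurable lebesgue"
        by (simp add: mult.assoc)
      show "AE x in lebesgue. w x * \<phi> x = indicator \<Omega> x *\<^sub>R (f x * \<phi> x)"
        using AE_completion[OF w] by eventually_elim auto
    qed (rule measurable_completion, simp)
    also have "\<dots> = 0"
      using test[OF \<phi>] by (simp add: integral_restrict_space)
    finally show ?thesis .
  qed
  then have "AE x in lborel. x \<in> \<Omega> \<longrightarrow> w x = 0"
    by (rule AE_eq_0_if_test_functions[OF int assms(1)])
  then have "AE x in lebesgue. x \<in> \<Omega> \<longrightarrow> w x = 0"
    by (rule AE_completion)
  then have "AE x in lebesgue. x \<in> \<Omega> \<longrightarrow> f x = 0"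
    using AE_completion[OF w] by eventually_elim auto
  then show ?thesis
    by (simp add: AE_restrict_space_iff)
qed

lemma weak_partial_unique:
  assumes "open \<Omega>" "bounded \<Omega>" "has_weak_partial \<Omega> i u w" "has_weak_partial \<Omega> i u z"
  shows "AE x in lebesgue_on \<Omega>. w x = z x"
proof -
  have "has_weak_partial \<Omega> i (\<lambda>x. 0) (\<lambda>x. w x - z x)"
    using has_weak_partial_diff[OF assms] by simp
  then have "AE x in lebesgue_on \<Omega>. w x - z x = 0"
    by (intro L2_eq_0_if_test_functions[OF assms(1,2)]) (auto simp: has_weak_partial_def)
  then show ?thesis by simp
qed

lemma sobolev_1_iff:
  "u \<in> sobolev \<Omega> 1 \<longleftrightarrow> u \<in> Lp 2 (lebesgue_on \<Omega>) \<and> (\<forall>i. \<exists>w. has_weak_partial \<Omega> i u w)"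
  by (auto simp: sobolev_def has_weak_partial_def)

text \<open>The choice in the definition of \<open>grad\<close> succeeds on
  \<open>H\<^sup>1\<close>.\<close>

lemma grad_weak_partial:
  "u \<in> sobolev \<Omega> 1 \<Longrightarrow> has_weak_partial \<Omega> i u (\<lambda>x. grad \<Omega> u x $ i)"
  unfolding sobolev_1_iff grad_def vec_lambda_beta by (metis someI_ex)

lemma sobolev_diff:
  assumes "open \<Omega>" "bounded \<Omega>" "u \<in> sobolev \<Omega> 1" "v \<in> sobolev \<Omega> 1"
  shows "(\<lambda>x. u x - v x) \<in> sobolev \<Omega> 1"
  unfolding sobolev_1_iff
proof (intro conjI allI)
  show "(\<lambda>x. u x - v x) \<in> Lp 2 (lebesgue_on \<Omega>)"
    using assms(3,4) by (intro L2_diff) (auto simp: sobolev_1_iff)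
  fix i
  obtain w z where "has_weak_partial \<Omega> i u w" "has_weak_partial \<Omega> i v z"
    using assms(3,4) unfolding sobolev_1_iff by blast
  from has_weak_partial_diff[OF assms(1,2) this]
  show "\<exists>w. has_weak_partial \<Omega> i (\<lambda>x. u x - v x) w"
    by (intro exI)
qed

text \<open>Gradients are arbitrary representatives, so linearity holds only almost everywhere, by
  uniqueness of weak derivatives.\<close>

lemma grad_diff:
  assumes "open \<Omega>" "bounded \<Omega>" "u \<in> sobolev \<Omega> 1" "v \<in> sobolev \<Omega> 1"
  shows "AE x in lebesgue_on \<Omega>. grad \<Omega> (\<lambda>x. u x - v x) x = grad \<Omega> u x - grad \<Omega> v x"
proof -
  have "AE x in lebesgue_on \<Omega>. grad \<Omega> (\<lambda>x. u x - v x) x $ i = grad \<Omega> u x $ i - grad \<Omega> v x $ i" for i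
    using assms by (intro weak_partial_unique[OF assms(1,2), where u="\<lambda>x. u x - v x" and i=i] has_weak_partial_diff
        grad_weak_partial sobolev_diff)
  then have "AE x in lebesgue_on \<Omega>. \<forall>i\<in>UNIV. grad \<Omega> (\<lambda>x. u x - v x) x $ i = grad \<Omega> u x $ i - grad \<Omega> v x $ i"
    by (intro AE_finite_allI) auto
  then show ?thesis
    by (simp add: vec_eq_iff)
qed

lemma borel_measurable_plane:
  fixes f :: "'a \<Rightarrow> plane"
  assumes "\<And>i. (\<lambda>x. f x $ i) \<in> borel_measurable M"
  shows "f \<in> borel_measurable M"
  using assms by (subst borel_measurable_euclidean_space) (auto simp: Basis_vec_def inner_axis)

lemma grad_measurable:
  "u \<in> sobolev \<Omega> 1 \<Longrightarrow> grad \<Omega> u \<in> borel_measurable (lebesgue_on \<Omega>)"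
  using grad_weak_partial by (intro borel_measurable_plane L2_D(1)) (auto simp: has_weak_partial_def)

lemma grad_square_integrable:
  assumes "u \<in> sobolev \<Omega> 1"
  shows "integrable (lebesgue_on \<Omega>) (\<lambda>x. (norm (grad \<Omega> u x))\<^sup>2)"
proof -
  have "integrable (lebesgue_on \<Omega>) (\<lambda>x. \<Sum>i\<in>UNIV. (grad \<Omega> u x $ i)\<^sup>2)"
    using grad_weak_partial[OF assms]
    by (intro Bochner_Integration.integrable_sum L2_D(2)) (auto simp: has_weak_partial_def)
  then show ?thesis
    by (simp add: norm_vec_def L2_set_def sum_nonneg)
qed

lemma L2_converges_diff:
  fixes f g :: "'a \<Rightarrow> 'b::{real_normed_vector, second_countable_topology}"
  assumes [measurable]: "\<And>n. F n \<in> borel_measurable M" "\<And>n. G n \<in> borel_measurable M"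
      "f \<in> borel_measurable M" "g \<in> borel_measurable M"
    and "L2_converges M F f" "L2_converges M G g"
  shows "L2_converges M (\<lambda>n x. F n x - G n x) (\<lambda>x. f x - g x)"
  unfolding L2_converges_def
proof (rule tendsto_sandwich[OF always_eventually always_eventually tendsto_const])
  let ?F = "\<lambda>n. \<integral>\<^sup>+x. ennreal ((norm (F n x - f x))\<^sup>2) \<partial>M"
  let ?G = "\<lambda>n. \<integral>\<^sup>+x. ennreal ((norm (G n x - g x))\<^sup>2) \<partial>M"
  have "(\<lambda>n. 2 * ?F n + 2 * ?G n) \<longlonglongrightarrow> 2 * 0 + 2 * 0"
    using assms(5,6) unfolding L2_converges_def
    by (intro tendsto_add ennreal_tendsto_cmult) auto
  then show "(\<lambda>n. 2 * ?F n + 2 * ?G n) \<longlonglongrightarrow> 0" by simp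
  show "\<forall>n. (\<integral>\<^sup>+x. ennreal ((norm (F n x - G n x - (f x - g x)))\<^sup>2) \<partial>M) \<le> 2 * ?F n + 2 * ?G n"
  proof
    fix n
    have le: "(norm (a - b))\<^sup>2 \<le> 2 * (norm a)\<^sup>2 + 2 * (norm b)\<^sup>2" for a b :: 'b
    proof -
      have "(norm (a - b))\<^sup>2 \<le> (norm a + norm b)\<^sup>2"
        by (intro power_mono norm_triangle_ineq4) simp
      also have "\<dots> \<le> 2 * (norm a)\<^sup>2 + 2 * (norm b)\<^sup>2"
        using zero_le_power2[of "norm a - norm b"] by (simp add: power2_eq_square algebra_simps)
      finally show ?thesis .
    qed
    have eq: "F n x - G n x - (f x - g x) = (F n x - f x) - (G n x - g x)" for x
      by simp
    have "(\<integral>\<^sup>+x. ennreal ((norm (F n x - G n x - (f x - g x)))\<^sup>2) \<partial>M) \<le>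
        (\<integral>\<^sup>+x. 2 * ennreal ((norm (F n x - f x))\<^sup>2) + 2 * ennreal ((norm (G n x - g x))\<^sup>2) \<partial>M)"
    proof (rule nn_integral_mono)
      fix x
      have "ennreal ((norm (F n x - G n x - (f x - g x)))\<^sup>2) \<le>
          ennreal (2 * (norm (F n x - f x))\<^sup>2 + 2 * (norm (G n x - g x))\<^sup>2)"
        unfolding eq by (intro ennreal_leI le)
      then show "ennreal ((norm (F n x - G n x - (f x - g x)))\<^sup>2) \<le>
          2 * ennreal ((norm (F n x - f x))\<^sup>2) + 2 * ennreal ((norm (G n x - g x))\<^sup>2)"
        by (simp add: ennreal_mult)
    qed
    also have "\<dots> = 2 * ?F n + 2 * ?G n"
      by (subst nn_integral_add) (auto simp: nn_integral_cmult)
    finally show "(\<integral>\<^sup>+x. ennreal ((norm (F n x - G n x - (f x - g x)))\<^sup>2) \<partial>M) \<le> 2 * ?F n + 2 * ?G n" .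
  qed
qed simp

text \<open>Measurability depends on the \<open>\<sigma>\<close>-algebra alone, which is the trace
  of the Borel \<open>\<sigma>\<close>-algebra on the boundary.\<close>

lemma smooth_boundary_measurable: "smooth \<phi> \<Longrightarrow> \<phi> \<in> borel_measurable (boundary_measure \<Omega>)"
proof -
  assume "smooth \<phi>"
  then have "\<phi> \<in> borel_measurable borel"
    by (intro borel_measurable_continuous_onI smooth_continuous)
  moreover have "sets (measure_of UNIV (sets borel) hausdorff1) = sets (borel :: plane measure)"
    using sets.sigma_sets_eq[of "borel :: plane measure"] by simp
  ultimately have "\<phi> \<in> borel_measurable (measure_of UNIV (sets borel) hausdorff1)"
    by (simp cong: measurable_cong_sets)
  then show ?thesis
    unfolding boundary_measure_def by (rule measurable_restrict_space1)
qed

text \<open>The differences of the two approximating sequences of smooth functions approximate the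
  difference, together with its gradient and its boundary values.\<close>

lemma is_trace_diff:
  assumes "open \<Omega>" "bounded \<Omega>" "is_trace \<Omega> u g" "is_trace \<Omega> v h"
  shows "is_trace \<Omega> (\<lambda>x. u x - v x) (\<lambda>x. g x - h x)"
proof -
  let ?D = "\<lambda>\<phi> x. (\<chi> i. partial i \<phi> x) :: plane"
  from assms(3) obtain \<phi> where u: "u \<in> sobolev \<Omega> 1" and g: "g \<in> Lp 2 (boundary_measure \<Omega>)"
    and \<phi>: "\<And>n. smooth (\<phi> n)" "L2_converges (lebesgue_on \<Omega>) \<phi> u"
      "L2_converges (lebesgue_on \<Omega>) (\<lambda>n. ?D (\<phi> n)) (grad \<Omega> u)"
      "L2_converges (boundary_measure \<Omega>) \<phi> g"
    unfolding is_trace_def by auto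
  from assms(4) obtain \<psi> where v: "v \<in> sobolev \<Omega> 1" and h: "h \<in> Lp 2 (boundary_measure \<Omega>)"
    and \<psi>: "\<And>n. smooth (\<psi> n)" "L2_converges (lebesgue_on \<Omega>) \<psi> v"
      "L2_converges (lebesgue_on \<Omega>) (\<lambda>n. ?D (\<psi> n)) (grad \<Omega> v)"
      "L2_converges (boundary_measure \<Omega>) \<psi> h"
    unfolding is_trace_def by auto
  have uv: "u \<in> borel_measurable (lebesgue_on \<Omega>)" "v \<in> borel_measurable (lebesgue_on \<Omega>)"
    using u v by (auto simp: sobolev_1_iff intro: L2_D(1))
  have D: "?D \<eta> \<in> borel_measurable (lebesgue_on \<Omega>)" if "smooth \<eta>" for \<eta>
    using that by (intro borel_measurable_plane)
      (simp add: smooth_lebesgue_measurable[OF assms(1)] smooth_partial)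
  have "L2_converges (lebesgue_on \<Omega>) (\<lambda>n x. \<phi> n x - \<psi> n x) (\<lambda>x. u x - v x)"
    using \<phi> \<psi> by (intro L2_converges_diff uv smooth_lebesgue_measurable[OF assms(1)])
  moreover have "L2_converges (boundary_measure \<Omega>) (\<lambda>n x. \<phi> n x - \<psi> n x) (\<lambda>x. g x - h x)"
    using \<phi> \<psi> g h by (intro L2_converges_diff smooth_boundary_measurable L2_D(1))
  moreover have "L2_converges (lebesgue_on \<Omega>) (\<lambda>n. ?D (\<lambda>x. \<phi> n x - \<psi> n x)) (grad \<Omega> (\<lambda>x. u x - v x))"
  proof -
    have "L2_converges (lebesgue_on \<Omega>) (\<lambda>n x. ?D (\<phi> n) x - ?D (\<psi> n) x) (\<lambda>x. grad \<Omega> u x - grad \<Omega> v x)"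
      using \<phi> \<psi> u v by (intro L2_converges_diff D grad_measurable)
    moreover have "?D (\<lambda>x. \<phi> n x - \<psi> n x) = (\<lambda>x. ?D (\<phi> n) x - ?D (\<psi> n) x)" for n
      by (intro ext) (simp add: vec_eq_iff partial_minus smooth_differentiable \<phi>(1) \<psi>(1))
    moreover have "(\<integral>\<^sup>+x. ennreal ((norm (f x - grad \<Omega> (\<lambda>x. u x - v x) x))\<^sup>2) \<partial>lebesgue_on \<Omega>) =
        (\<integral>\<^sup>+x. ennreal ((norm (f x - (grad \<Omega> u x - grad \<Omega> v x)))\<^sup>2) \<partial>lebesgue_on \<Omega>)" for f
      using grad_diff[OF assms(1,2) u v] by (intro nn_integral_cong_AE) auto
    ultimately show ?thesis
      by (simp add: L2_converges_def)
  qed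
  moreover have "smooth (\<lambda>x. \<phi> n x - \<psi> n x)" for n
    using \<phi> \<psi> by (intro smooth_minus)
  ultimately show ?thesis
    using sobolev_diff[OF assms(1,2) u v] L2_diff[OF g h] unfolding is_trace_def
    by (intro conjI exI[where x="\<lambda>n x. \<phi> n x - \<psi> n x"]) simp_all
qed

section \<open>Dependence of the power densities on the conductivity\<close>

lemma integrable_weighted_inner:
  fixes G W :: "'a \<Rightarrow> 'b::{real_inner, second_countable_topology}"
  assumes [measurable]: "s \<in> borel_measurable M" "G \<in> borel_measurable M" "W \<in> borel_measurable M"
    and G: "integrable M (\<lambda>x. (norm (G x))\<^sup>2)" and W: "integrable M (\<lambda>x. (norm (W x))\<^sup>2)"
    and s: "AE x in M. \<bar>s x\<bar> \<le> B"
  shows "integrable M (\<lambda>x. s x * (G x \<bullet> W x))"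
proof (rule Bochner_Integration.integrable_bound)
  show "integrable M (\<lambda>x. B * ((norm (G x))\<^sup>2 + (norm (W x))\<^sup>2))"
    using G W by simp
  show "AE x in M. norm (s x * (G x \<bullet> W x)) \<le> norm (B * ((norm (G x))\<^sup>2 + (norm (W x))\<^sup>2))"
    using s
  proof eventually_elim
    fix x assume "\<bar>s x\<bar> \<le> B"
    have "\<bar>G x \<bullet> W x\<bar> \<le> norm (G x) * norm (W x)"
      by (rule Cauchy_Schwarz_ineq2)
    also have "\<dots> \<le> (norm (G x))\<^sup>2 + (norm (W x))\<^sup>2"
      using sum_squares_bound[of "norm (G x)" "norm (W x)"]
        mult_nonneg_nonneg[OF norm_ge_zero[of "G x"] norm_ge_zero[of "W x"]]
      by linarith
    finally have "\<bar>s x\<bar> * \<bar>G x \<bullet> W x\<bar> \<le> B * ((norm (G x))\<^sup>2 + (norm (W x))\<^sup>2)"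
      using \<open>\<bar>s x\<bar> \<le> B\<close> by (intro mult_mono) auto
    then show "norm (s x * (G x \<bullet> W x)) \<le> norm (B * ((norm (G x))\<^sup>2 + (norm (W x))\<^sup>2))"
      by (simp only: real_norm_def abs_mult[of "s x"])
  qed
qed simp

text \<open>Write \<open>w = u - v\<close>. Testing both equations with \<open>w\<close> gives
  \<open>\<integral> \<rho> |\<nabla>w|\<^sup>2 = \<integral> (\<rho> - \<sigma>) \<nabla>u
  \<bullet> \<nabla>w\<close>. The left-hand side is at least \<open>c \<integral>
  |\<nabla>w|\<^sup>2\<close>, and on the right Young's inequality lets half of this be
  absorbed.\<close>

lemma weak_solution_stability:
  assumes \<Omega>: "open \<Omega>" "bounded \<Omega>" and "0 < c"
    and u: "weak_solution \<Omega> \<sigma> g u" and v: "weak_solution \<Omega> \<rho> g v"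
    and [measurable]: "\<sigma> \<in> borel_measurable (lebesgue_on \<Omega>)" "\<rho> \<in> borel_measurable (lebesgue_on \<Omega>)"
    and \<sigma>: "AE x in lebesgue_on \<Omega>. c < \<sigma> x \<and> \<sigma> x < B"
    and \<rho>: "AE x in lebesgue_on \<Omega>. c < \<rho> x \<and> \<rho> x < B"
    and close: "AE x in lebesgue_on \<Omega>. \<bar>\<sigma> x - \<rho> x\<bar> \<le> \<epsilon>"
  shows "(\<integral>x. (norm (grad \<Omega> u x - grad \<Omega> v x))\<^sup>2 \<partial>lebesgue_on \<Omega>)
    \<le> (\<epsilon> / c)\<^sup>2 * (\<integral>x. (norm (grad \<Omega> u x))\<^sup>2 \<partial>lebesgue_on \<Omega>)"
proof -
  let ?M = "lebesgue_on \<Omega>" and ?w = "\<lambda>x. u x - v x"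
  let ?G = "grad \<Omega> u" and ?H = "grad \<Omega> v" and ?W = "grad \<Omega> (\<lambda>x. u x - v x)"
  have S: "u \<in> sobolev \<Omega> 1" "v \<in> sobolev \<Omega> 1"
    using u v by (auto simp: weak_solution_def)
  then have "?w \<in> sobolev \<Omega> 1"
    by (rule sobolev_diff[OF \<Omega>])
  note S = S this
  have "is_trace \<Omega> ?w (\<lambda>_. 0)"
    using is_trace_diff[OF \<Omega>, of u g v g] u v by (simp add: weak_solution_def)
  then have weak: "(\<integral>x. \<sigma> x * (?G x \<bullet> ?W x) \<partial>?M) = 0" "(\<integral>x. \<rho> x * (?H x \<bullet> ?W x) \<partial>?M) = 0"
    using u v S(3) by (auto simp: weak_solution_def)
  note [measurable] = S[THEN grad_measurable]
  note sq = S[THEN grad_square_integrable]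
  have bound: "AE x in ?M. \<bar>\<sigma> x\<bar> \<le> B" "AE x in ?M. \<bar>\<rho> x\<bar> \<le> B"
    using \<sigma> \<rho> \<open>0 < c\<close> by (auto elim: eventually_mono)
  have W: "AE x in ?M. ?W x = ?G x - ?H x"
    by (rule grad_diff[OF \<Omega> S(1,2)])
  have int: "integrable ?M (\<lambda>x. \<sigma> x * (?G x \<bullet> ?W x))" "integrable ?M (\<lambda>x. \<rho> x * (?G x \<bullet> ?W x))"
      "integrable ?M (\<lambda>x. \<rho> x * (?H x \<bullet> ?W x))" "integrable ?M (\<lambda>x. \<rho> x * (?W x \<bullet> ?W x))"
    using sq bound by (auto intro!: integrable_weighted_inner)
  have "c * (\<integral>x. (norm (?W x))\<^sup>2 \<partial>?M) = (\<integral>x. c * (norm (?W x))\<^sup>2 \<partial>?M)"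
    by simp
  also have "\<dots> \<le> (\<integral>x. \<rho> x * (?W x \<bullet> ?W x) \<partial>?M)"
    using sq(3) int(4) \<rho>
    by (intro integral_mono_AE)
       (auto simp: power2_norm_eq_inner intro!: mult_right_mono elim!: eventually_mono)
  also have "\<dots> = (\<integral>x. \<rho> x * (?G x \<bullet> ?W x) - \<rho> x * (?H x \<bullet> ?W x) \<partial>?M)"
  proof (rule integral_cong_AE)
    show "AE x in ?M. \<rho> x * (?W x \<bullet> ?W x) = \<rho> x * (?G x \<bullet> ?W x) - \<rho> x * (?H x \<bullet> ?W x)"
      using W
    proof eventually_elim
      fix x assume "?W x = ?G x - ?H x"
      then have "?W x \<bullet> ?W x = (?G x - ?H x) \<bullet> ?W x"
        by (rule arg_cong)
      then show "\<rho> x * (?W x \<bullet> ?W x) = \<rho> x * (?G x \<bullet> ?W x) - \<rho> x * (?H x \<bullet> ?W x)"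
        by (simp add: inner_diff_left right_diff_distrib)
    qed
  qed auto
  also have "\<dots> = (\<integral>x. \<rho> x * (?G x \<bullet> ?W x) \<partial>?M) - (\<integral>x. \<sigma> x * (?G x \<bullet> ?W x) \<partial>?M)"
    using int weak by simp
  also have "\<dots> = (\<integral>x. \<rho> x * (?G x \<bullet> ?W x) - \<sigma> x * (?G x \<bullet> ?W x) \<partial>?M)"
    using int by simp
  also have "\<dots> \<le> (\<integral>x. c / 2 * (norm (?W x))\<^sup>2 + \<epsilon>\<^sup>2 / (2 * c) * (norm (?G x))\<^sup>2 \<partial>?M)"
  proof (rule integral_mono_AE)
    show "AE x in ?M. \<rho> x * (?G x \<bullet> ?W x) - \<sigma> x * (?G x \<bullet> ?W x)
        \<le> c / 2 * (norm (?W x))\<^sup>2 + \<epsilon>\<^sup>2 / (2 * c) * (norm (?G x))\<^sup>2"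
      using close
    proof eventually_elim
      fix x assume *: "\<bar>\<sigma> x - \<rho> x\<bar> \<le> \<epsilon>"
      have "\<rho> x * (?G x \<bullet> ?W x) - \<sigma> x * (?G x \<bullet> ?W x) \<le> \<bar>(\<rho> x - \<sigma> x) * (?G x \<bullet> ?W x)\<bar>"
        by (simp add: left_diff_distrib)
      also have "\<dots> \<le> \<epsilon> * (norm (?G x) * norm (?W x))"
        unfolding abs_mult using * by (intro mult_mono Cauchy_Schwarz_ineq2) auto
      also have "\<dots> \<le> c / 2 * (norm (?W x))\<^sup>2 + \<epsilon>\<^sup>2 / (2 * c) * (norm (?G x))\<^sup>2"
      proof -
        \<comment> \<open>Young's inequality; the weight \<open>c\<close> leaves half of the coercive term for the left-hand side\<close>
        have "0 \<le> (c * norm (?W x) - \<epsilon> * norm (?G x))\<^sup>2 / (2 * c)"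
          using \<open>0 < c\<close> by simp
        also have "\<dots> = c / 2 * (norm (?W x))\<^sup>2 + \<epsilon>\<^sup>2 / (2 * c) * (norm (?G x))\<^sup>2 - \<epsilon> * (norm (?G x) * norm (?W x))"
          using \<open>0 < c\<close> by (simp add: field_simps power2_eq_square)
        finally show ?thesis by simp
      qed
      finally show "\<rho> x * (?G x \<bullet> ?W x) - \<sigma> x * (?G x \<bullet> ?W x)
        \<le> c / 2 * (norm (?W x))\<^sup>2 + \<epsilon>\<^sup>2 / (2 * c) * (norm (?G x))\<^sup>2" .
    qed
  qed (use sq int in auto)
  also have "\<dots> = c / 2 * (\<integral>x. (norm (?W x))\<^sup>2 \<partial>?M) + \<epsilon>\<^sup>2 / (2 * c) * (\<integral>x. (norm (?G x))\<^sup>2 \<partial>?M)"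
    using sq by simp
  finally have "(\<integral>x. (norm (?W x))\<^sup>2 \<partial>?M) \<le> (\<epsilon> / c)\<^sup>2 * (\<integral>x. (norm (?G x))\<^sup>2 \<partial>?M)"
    using \<open>0 < c\<close> by (simp add: field_simps power2_eq_square)
  moreover have "(\<integral>x. (norm (?G x - ?H x))\<^sup>2 \<partial>?M) = (\<integral>x. (norm (?W x))\<^sup>2 \<partial>?M)"
    using W by (intro integral_cong_AE) auto
  ultimately show ?thesis by simp
qed

lemma Linf_dist_AE:
  assumes "Linf_dist \<Omega> \<sigma> \<rho> < ereal \<epsilon>"
  shows "AE x in lebesgue_on \<Omega>. \<bar>\<sigma> x - \<rho> x\<bar> \<le> \<epsilon>"
  using esssup_AE[of "\<lambda>x. ereal \<bar>\<sigma> x - \<rho> x\<bar>" "lebesgue_on \<Omega>"] assms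
  unfolding Linf_dist_def by (auto elim!: eventually_mono dest: order_le_less_trans)

text \<open>By the stability estimate the gradients converge in \<open>L\<^sup>2\<close>, so along
  a subsequence everything entering the power density converges almost everywhere, and Fatou's lemma
  applies.\<close>

lemma power_density_lsc:
  assumes \<Omega>: "open \<Omega>" "bounded \<Omega>" and "0 < c"
    and meas[measurable]: "\<And>n::nat. s n \<in> borel_measurable (lebesgue_on \<Omega>)" "\<sigma> \<in> borel_measurable (lebesgue_on \<Omega>)"
      "y \<in> borel_measurable (lebesgue_on \<Omega>)"
    and bounds: "\<And>n. AE x in lebesgue_on \<Omega>. c < s n x \<and> s n x < B" "AE x in lebesgue_on \<Omega>. c < \<sigma> x \<and> \<sigma> x < B"
    and sol: "weak_solution \<Omega> \<sigma> g1 u1" "weak_solution \<Omega> \<sigma> g2 u2"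
      "\<And>n. weak_solution \<Omega> (s n) g1 (v1 n)" "\<And>n. weak_solution \<Omega> (s n) g2 (v2 n)"
    and close: "\<And>n. Linf_dist \<Omega> \<sigma> (s n) < ereal (1 / Suc n)"
    and le: "\<And>n. (\<integral>\<^sup>+x. ennreal (\<bar>power_density \<Omega> (s n) (v1 n) (v2 n) x - y x\<bar> ^ l) \<partial>lebesgue_on \<Omega>) \<le> C"
  shows "(\<integral>\<^sup>+x. ennreal (\<bar>power_density \<Omega> \<sigma> u1 u2 x - y x\<bar> ^ l) \<partial>lebesgue_on \<Omega>) \<le> C"
proof -
  let ?M = "lebesgue_on \<Omega>"
  let ?e1 = "\<lambda>n x. (norm (grad \<Omega> u1 x - grad \<Omega> (v1 n) x))\<^sup>2"
  let ?e2 = "\<lambda>n x. (norm (grad \<Omega> u2 x - grad \<Omega> (v2 n) x))\<^sup>2"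
  have S: "u1 \<in> sobolev \<Omega> 1" "u2 \<in> sobolev \<Omega> 1" "\<And>n. v1 n \<in> sobolev \<Omega> 1" "\<And>n. v2 n \<in> sobolev \<Omega> 1"
    using sol by (auto simp: weak_solution_def)
  note [measurable] = S[THEN grad_measurable]
  have near: "AE x in ?M. \<bar>\<sigma> x - s n x\<bar> \<le> 1 / Suc n" for n
    by (rule Linf_dist_AE[OF close])
  have int: "integrable ?M (\<lambda>x. (norm (grad \<Omega> u x - grad \<Omega> v x))\<^sup>2)"
    if "u \<in> sobolev \<Omega> 1" "v \<in> sobolev \<Omega> 1" for u v
    using grad_square_integrable[OF sobolev_diff[OF \<Omega> that]] grad_diff[OF \<Omega> that]
      that[THEN grad_measurable]
    by (elim integrable_cong_AE_imp) (auto elim: eventually_mono)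
  have zero: "(\<lambda>n. \<integral>x. (norm (grad \<Omega> u x - grad \<Omega> (v n) x))\<^sup>2 \<partial>?M) \<longlonglongrightarrow> 0"
    if u: "weak_solution \<Omega> \<sigma> g u" and v: "\<And>n. weak_solution \<Omega> (s n) g (v n)" for g u v
  proof (rule tendsto_sandwich[OF always_eventually always_eventually tendsto_const])
    show "\<forall>n. (\<integral>x. (norm (grad \<Omega> u x - grad \<Omega> (v n) x))\<^sup>2 \<partial>?M)
        \<le> (1 / Suc n / c)\<^sup>2 * (\<integral>x. (norm (grad \<Omega> u x))\<^sup>2 \<partial>?M)"
      by (intro allI weak_solution_stability[OF \<Omega> \<open>0 < c\<close> u v meas(2,1) bounds(2,1) near])
    have "(\<lambda>n. (1 / Suc n / c)\<^sup>2 * (\<integral>x. (norm (grad \<Omega> u x))\<^sup>2 \<partial>?M)) \<longlonglongrightarrow>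
        (0 / c)\<^sup>2 * (\<integral>x. (norm (grad \<Omega> u x))\<^sup>2 \<partial>?M)"
      using LIMSEQ_Suc[OF lim_1_over_n] by (intro tendsto_intros) (use \<open>0 < c\<close> in auto)
    then show "(\<lambda>n. (1 / Suc n / c)\<^sup>2 * (\<integral>x. (norm (grad \<Omega> u x))\<^sup>2 \<partial>?M)) \<longlonglongrightarrow> 0"
      by simp
  qed simp
  have "(\<lambda>n. \<integral>x. norm (?e1 n x + ?e2 n x) \<partial>?M) \<longlonglongrightarrow> 0 + 0"
    using tendsto_add[OF zero[OF sol(1,3)] zero[OF sol(2,4)]] int S by simp
  then obtain r where r: "strict_mono r"
    and conv: "AE x in ?M. (\<lambda>n. ?e1 (r n) x + ?e2 (r n) x) \<longlonglongrightarrow> 0"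
    using tendsto_L1_AE_subseq[of ?M "\<lambda>n x. ?e1 n x + ?e2 n x"] int S by auto
  have "AE x in ?M. \<forall>n. \<bar>\<sigma> x - s n x\<bar> \<le> 1 / Suc n"
    using near by (simp add: AE_all_countable)
  with conv have lim: "AE x in ?M. (\<lambda>n. ennreal (\<bar>power_density \<Omega> (s (r n)) (v1 (r n)) (v2 (r n)) x - y x\<bar> ^ l))
      \<longlonglongrightarrow> ennreal (\<bar>power_density \<Omega> \<sigma> u1 u2 x - y x\<bar> ^ l)"
  proof eventually_elim
    fix x assume conv: "(\<lambda>n. ?e1 (r n) x + ?e2 (r n) x) \<longlonglongrightarrow> 0"
      and near: "\<forall>n. \<bar>\<sigma> x - s n x\<bar> \<le> 1 / Suc n"
    have norm_0: "(\<lambda>n. W n) \<longlonglongrightarrow> a" if "\<And>n. (norm (a - W n))\<^sup>2 \<le> ?e1 (r n) x + ?e2 (r n) x"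
      for a :: plane and W
    proof -
      have "(\<lambda>n. (norm (a - W n))\<^sup>2) \<longlonglongrightarrow> 0"
        by (rule tendsto_sandwich[OF always_eventually always_eventually tendsto_const conv])
           (use that in auto)
      then have "(\<lambda>n. sqrt ((norm (a - W n))\<^sup>2)) \<longlonglongrightarrow> sqrt 0"
        by (rule tendsto_real_sqrt)
      then have "(\<lambda>n. W n - a) \<longlonglongrightarrow> 0"
        by (subst tendsto_norm_zero_iff[symmetric]) (simp add: norm_minus_commute)
      then show ?thesis by (simp add: LIM_zero_iff)
    qed
    have "(\<lambda>n. grad \<Omega> (v1 (r n)) x) \<longlonglongrightarrow> grad \<Omega> u1 x" "(\<lambda>n. grad \<Omega> (v2 (r n)) x) \<longlonglongrightarrow> grad \<Omega> u2 x"
      by (rule norm_0, simp)+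
    moreover have "(\<lambda>n. s n x - \<sigma> x) \<longlonglongrightarrow> 0"
      by (rule Lim_null_comparison[OF _ LIMSEQ_Suc[OF lim_1_over_n]])
         (use near in \<open>auto simp: abs_minus_commute\<close>)
    then have "(\<lambda>n. s n x) \<longlonglongrightarrow> \<sigma> x"
      by (simp add: LIM_zero_iff)
    then have "(\<lambda>n. s (r n) x) \<longlonglongrightarrow> \<sigma> x"
      using LIMSEQ_subseq_LIMSEQ[OF _ r] by (force simp: o_def)
    ultimately show "(\<lambda>n. ennreal (\<bar>power_density \<Omega> (s (r n)) (v1 (r n)) (v2 (r n)) x - y x\<bar> ^ l))
      \<longlonglongrightarrow> ennreal (\<bar>power_density \<Omega> \<sigma> u1 u2 x - y x\<bar> ^ l)"
      unfolding power_density_def by (intro tendsto_intros tendsto_ennrealI)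
  qed
  have "(\<integral>\<^sup>+x. ennreal (\<bar>power_density \<Omega> \<sigma> u1 u2 x - y x\<bar> ^ l) \<partial>?M) =
      (\<integral>\<^sup>+x. liminf (\<lambda>n. ennreal (\<bar>power_density \<Omega> (s (r n)) (v1 (r n)) (v2 (r n)) x - y x\<bar> ^ l)) \<partial>?M)"
    using lim by (intro nn_integral_cong_AE, eventually_elim) (simp only: lim_imp_Liminf[OF trivial_limit_sequentially])
  also have "\<dots> \<le> liminf (\<lambda>n. \<integral>\<^sup>+x. ennreal (\<bar>power_density \<Omega> (s (r n)) (v1 (r n)) (v2 (r n)) x - y x\<bar> ^ l) \<partial>?M)"
    unfolding power_density_def by (intro nn_integral_liminf) measurable
  also have "\<dots> \<le> C"
    by (intro Liminf_le always_eventually allI le) simp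
  finally show ?thesis .
qed

text \<open>The hypothesis is sequential lower semicontinuity, restricted to sequences converging
  at the rate \<open>1 / Suc n\<close>; it makes the sets \<open>{\<sigma>. C < f \<sigma>}\<close>
  open.\<close>

lemma Linf_lsc_measurable:
  fixes f :: "(plane \<Rightarrow> real) \<Rightarrow> ennreal"
  assumes "\<And>\<sigma> s C. \<sigma> \<in> S \<Longrightarrow> (\<And>n::nat. s n \<in> S) \<Longrightarrow> (\<And>n. Linf_dist \<Omega> \<sigma> (s n) < ereal (1 / Suc n)) \<Longrightarrow>
      (\<And>n. f (s n) \<le> C) \<Longrightarrow> f \<sigma> \<le> C"
  shows "f \<in> borel_measurable (Linf_borel \<Omega> S)"
proof (rule borel_measurableI_greater)
  fix C
  let ?O = "{U. U \<subseteq> S \<and> (\<forall>\<sigma>\<in>U. \<exists>\<epsilon>>0. \<forall>\<sigma>'\<in>S. Linf_dist \<Omega> \<sigma> \<sigma>' < ereal \<epsilon> \<longrightarrow> \<sigma>' \<in> U)}"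
  have "\<exists>\<epsilon>>0. \<forall>\<rho>\<in>S. Linf_dist \<Omega> \<sigma> \<rho> < ereal \<epsilon> \<longrightarrow> C < f \<rho>" if "\<sigma> \<in> S" "C < f \<sigma>" for \<sigma>
  proof (rule ccontr)
    assume "\<not> ?thesis"
    then have "\<exists>\<rho>\<in>S. Linf_dist \<Omega> \<sigma> \<rho> < ereal (1 / Suc n) \<and> f \<rho> \<le> C" for n
      by (metis not_le of_nat_0_less_iff zero_less_Suc zero_less_divide_1_iff)
    then obtain s where "\<And>n::nat. s n \<in> S" "\<And>n. Linf_dist \<Omega> \<sigma> (s n) < ereal (1 / Suc n)" "\<And>n. f (s n) \<le> C"
      by metis
    from assms[OF \<open>\<sigma> \<in> S\<close> this] \<open>C < f \<sigma>\<close> show False by simp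
  qed
  then have "{\<sigma> \<in> S. C < f \<sigma>} \<in> ?O"
    by auto
  then show "{\<sigma> \<in> space (Linf_borel \<Omega> S). C < f \<sigma>} \<in> sets (Linf_borel \<Omega> S)"
    unfolding Linf_borel_def by (subst sets_measure_of space_measure_of; auto)+
qed

lemma power_density_measurable:
  assumes "\<sigma> \<in> borel_measurable (lebesgue_on \<Omega>)" "weak_solution \<Omega> \<sigma> g u" "weak_solution \<Omega> \<sigma> k v"
  shows "power_density \<Omega> \<sigma> u v \<in> borel_measurable (lebesgue_on \<Omega>)"
proof -
  have [measurable]: "grad \<Omega> u \<in> borel_measurable (lebesgue_on \<Omega>)" "grad \<Omega> v \<in> borel_measurable (lebesgue_on \<Omega>)"
    using assms by (auto simp: weak_solution_def intro: grad_measurable)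
  note [measurable] = assms(1)
  show ?thesis
    unfolding power_density_def by measurable
qed

lemma power_density_L1:
  assumes "\<sigma> \<in> borel_measurable (lebesgue_on \<Omega>)" "AE x in lebesgue_on \<Omega>. 0 < \<sigma> x \<and> \<sigma> x < B"
    and "weak_solution \<Omega> \<sigma> g u" "weak_solution \<Omega> \<sigma> k v"
  shows "power_density \<Omega> \<sigma> u v \<in> Lp 1 (lebesgue_on \<Omega>)"
proof -
  have "u \<in> sobolev \<Omega> 1" "v \<in> sobolev \<Omega> 1"
    using assms by (auto simp: weak_solution_def)
  then have "integrable (lebesgue_on \<Omega>) (power_density \<Omega> \<sigma> u v)"
    unfolding power_density_def using assms(2)
    by (intro integrable_weighted_inner[where B=B] assms(1) grad_measurable grad_square_integrable)
       (auto elim: eventually_mono)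
  then show ?thesis
    using power_density_measurable[OF assms(1,3,4)] by (simp add: Lp_def)
qed

lemma space_Linf_borel: "space (Linf_borel \<Omega> S) = S"
  unfolding Linf_borel_def by (rule space_measure_of) auto

lemma residual_norm_measurable:
  assumes \<Omega>: "open \<Omega>" "bounded \<Omega>" and "0 < c"
    and meas: "\<And>\<sigma>. \<sigma> \<in> S \<Longrightarrow> \<sigma> \<in> borel_measurable (lebesgue_on \<Omega>)"
    and bounds: "\<And>\<sigma>. \<sigma> \<in> S \<Longrightarrow> AE x in lebesgue_on \<Omega>. c < \<sigma> x \<and> \<sigma> x < B"
    and sol: "\<And>\<sigma>. \<sigma> \<in> S \<Longrightarrow> weak_solution \<Omega> \<sigma> g (u \<sigma>)" "\<And>\<sigma>. \<sigma> \<in> S \<Longrightarrow> weak_solution \<Omega> \<sigma> k (v \<sigma>)"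
    and y: "y \<in> borel_measurable (lebesgue_on \<Omega>)"
  shows "(\<lambda>\<sigma>. Lp_norm l (lebesgue_on \<Omega>) (\<lambda>x. power_density \<Omega> \<sigma> (u \<sigma>) (v \<sigma>) x - y x)) \<in> borel_measurable (Linf_borel \<Omega> S)"
proof -
  let ?f = "\<lambda>\<sigma> x. \<bar>power_density \<Omega> \<sigma> (u \<sigma>) (v \<sigma>) x - y x\<bar> ^ l"
  have "(\<lambda>\<sigma>. \<integral>\<^sup>+x. ennreal (?f \<sigma> x) \<partial>lebesgue_on \<Omega>) \<in> borel_measurable (Linf_borel \<Omega> S)"
  proof (rule Linf_lsc_measurable)
    fix \<sigma> s C
    assume S: "\<sigma> \<in> S" "\<And>n::nat. s n \<in> S"
      and close: "\<And>n. Linf_dist \<Omega> \<sigma> (s n) < ereal (1 / Suc n)"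
      and le: "\<And>n. (\<integral>\<^sup>+x. ennreal (?f (s n) x) \<partial>lebesgue_on \<Omega>) \<le> C"
    show "(\<integral>\<^sup>+x. ennreal (?f \<sigma> x) \<partial>lebesgue_on \<Omega>) \<le> C"
      by (rule power_density_lsc[OF \<Omega> \<open>0 < c\<close> meas[OF S(2)] meas[OF S(1)] y bounds[OF S(2)]
            bounds[OF S(1)] sol(1)[OF S(1)] sol(2)[OF S(1)] sol(1)[OF S(2)] sol(2)[OF S(2)] close le])
  qed
  then have "(\<lambda>\<sigma>. root l (enn2real (\<integral>\<^sup>+x. ennreal (?f \<sigma> x) \<partial>lebesgue_on \<Omega>))) \<in> borel_measurable (Linf_borel \<Omega> S)"
    by measurable
  moreover have "Lp_norm l (lebesgue_on \<Omega>) (\<lambda>x. power_density \<Omega> \<sigma> (u \<sigma>) (v \<sigma>) x - y x) =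
      root l (enn2real (\<integral>\<^sup>+x. ennreal (?f \<sigma> x) \<partial>lebesgue_on \<Omega>))" if "\<sigma> \<in> S" for \<sigma>
  proof -
    note [measurable] = y power_density_measurable[OF meas sol, OF that that that]
    show ?thesis
      unfolding Lp_norm_def by (subst integral_eq_nn_integral) auto
  qed
  ultimately show ?thesis
    by (subst measurable_cong) (simp_all add: space_Linf_borel)
qed

section \<open>Dependence of the likelihood on the data\<close>

lemma neg_log_likelihood_nonneg:
  assumes "\<And>i j. i \<in> {1..d} \<Longrightarrow> j \<in> {1..d} \<Longrightarrow> \<tau> i j > 0"
  shows "0 \<le> neg_log_likelihood \<Omega> l d \<tau> h y \<sigma>"
  unfolding neg_log_likelihood_def
  by (intro sum_nonneg divide_nonneg_nonneg mult_nonneg_nonneg zero_le_power Lp_norm_nonneg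
      of_nat_0_le_iff assms[THEN less_imp_le])

text \<open>The function \<open>\<psi> s = exp (- s\<^sup>l / (2 l))\<close> satisfies
  \<open>|\<psi>' s| = s\<^sup>l\<^sup>-\<^sup>1 / 2 * \<psi> s \<le> 1\<close> on \<open>[0,
  \<infinity>)\<close>, because \<open>s\<^sup>l\<^sup>-\<^sup>1 / 2 \<le> 1 + s\<^sup>l / (2 l)
  \<le> exp (s\<^sup>l / (2 l))\<close> for these two values of \<open>l\<close>.\<close>

lemma exp_neg_power_Lipschitz:
  fixes a b t :: real
  assumes "0 \<le> a" "0 \<le> b" "0 < t" "l \<in> {1, 2::nat}"
  shows "\<bar>exp (- (a ^ l / (real l * t ^ l) / 2)) - exp (- (b ^ l / (real l * t ^ l) / 2))\<bar> \<le> \<bar>a - b\<bar> / t"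
proof -
  let ?\<phi> = "\<lambda>s::real. exp (- (s ^ l / (2 * real l)))"
  have deriv: "(?\<phi> has_real_derivative - (s ^ (l - 1) / 2) * ?\<phi> s) (at s)" for s
    using DERIV_fun_exp[OF DERIV_minus[OF DERIV_cdivide[OF DERIV_pow]], of l "2 * real l" s] assms(4)
    by (auto simp: mult.commute)
  have bound: "\<bar>- (s ^ (l - 1) / 2) * ?\<phi> s\<bar> \<le> 1" if "0 \<le> s" for s
  proof -
    have "s ^ (l - 1) / 2 \<le> 1 + s ^ l / (2 * real l)"
    proof (cases "l = 1")
      case True
      with that show ?thesis by simp
    next
      case False
      then have "l = 2" using assms(4) by simp
      have "0 \<le> (s - 1)\<^sup>2"
        by simp
      also have "\<dots> = s\<^sup>2 - 2 * s + 1"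
        by (simp add: power2_diff)
      finally have "s / 2 \<le> 1 + s\<^sup>2 / 4"
        by linarith
      then show ?thesis
        unfolding \<open>l = 2\<close> by simp
    qed
    also have "\<dots> \<le> exp (s ^ l / (2 * real l))"
      by (rule exp_ge_add_one_self)
    finally show ?thesis
      using that by (simp add: abs_mult exp_minus field_simps)
  qed
  have "\<bar>?\<phi> (a / t) - ?\<phi> (b / t)\<bar> \<le> 1 * \<bar>a / t - b / t\<bar>"
    using field_differentiable_bound[of "{0..}" ?\<phi> "\<lambda>s. - (s ^ (l - 1) / 2) * ?\<phi> s" 1 "a / t" "b / t"]
      has_field_derivative_at_within[OF deriv] bound assms by simp
  then show ?thesis
    using \<open>0 < t\<close> by (simp add: power_divide diff_divide_distrib[symmetric] ac_simps)
qed

lemma neg_log_likelihood_pairs: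
  "neg_log_likelihood \<Omega> l d \<tau> h y \<sigma> =
     (\<Sum>(i, j)\<in>{1..d} \<times> {1..d}. Lp_norm l (lebesgue_on \<Omega>) (\<lambda>x. h i j \<sigma> x - y i j x) ^ l / (real l * \<tau> i j ^ l))"
  unfolding neg_log_likelihood_def by (simp add: sum.cartesian_product)

text \<open>The root likelihood is a product of factors in \<open>[0, 1]\<close>, so the
  difference of two such products is at most the sum of the differences of the factors. Each of
  these is controlled by the reverse triangle inequality for the residual norms.\<close>

lemma root_likelihood_Lipschitz:
  assumes l: "l \<in> {1, 2}" and \<tau>: "\<And>i j. i \<in> {1..d} \<Longrightarrow> j \<in> {1..d} \<Longrightarrow> \<tau> i j > 0"
    and h: "\<And>i j. i \<in> {1..d} \<Longrightarrow> j \<in> {1..d} \<Longrightarrow> h i j \<sigma> \<in> Lp l (lebesgue_on \<Omega>)"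
    and y: "y1 \<in> data_space \<Omega> l d" "y2 \<in> data_space \<Omega> l d"
  shows "\<bar>exp (- (neg_log_likelihood \<Omega> l d \<tau> h y1 \<sigma> / 2)) - exp (- (neg_log_likelihood \<Omega> l d \<tau> h y2 \<sigma> / 2))\<bar>
    \<le> (\<Sum>i=1..d. \<Sum>j=1..d. 1 / \<tau> i j) * (\<Sum>i=1..d. \<Sum>j=1..d. Lp_norm l (lebesgue_on \<Omega>) (\<lambda>x. y1 i j x - y2 i j x))"
proof -
  let ?I = "{1..d} \<times> {1..d}"
  let ?N = "\<lambda>y i j. Lp_norm l (lebesgue_on \<Omega>) (\<lambda>x. h i j \<sigma> x - y i j x)"
  let ?f = "\<lambda>y (i, j). exp (- (?N y i j ^ l / (real l * \<tau> i j ^ l) / 2))"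
  let ?D = "\<lambda>(i, j). Lp_norm l (lebesgue_on \<Omega>) (\<lambda>x. y1 i j x - y2 i j x)"
  let ?T = "\<lambda>(i, j). 1 / \<tau> i j"
  have prod: "exp (- (neg_log_likelihood \<Omega> l d \<tau> h y \<sigma> / 2)) = prod (?f y) ?I" for y
    unfolding neg_log_likelihood_pairs
    by (simp add: exp_sum[symmetric] sum_negf[symmetric] sum_divide_distrib case_prod_beta)
  have le1: "norm (?f y q) \<le> 1" if "q \<in> ?I" for y q
    using that by (auto intro!: divide_nonneg_nonneg mult_nonneg_nonneg zero_le_power Lp_norm_nonneg \<tau>[THEN less_imp_le])
  have "norm (prod (?f y1) ?I - prod (?f y2) ?I) \<le> (\<Sum>q\<in>?I. norm (?f y1 q - ?f y2 q))"
    by (rule norm_prod_diff; rule le1)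
  then have "\<bar>prod (?f y1) ?I - prod (?f y2) ?I\<bar> \<le> (\<Sum>q\<in>?I. \<bar>?f y1 q - ?f y2 q\<bar>)"
    by (simp only: real_norm_def)
  also have "\<dots> \<le> (\<Sum>q\<in>?I. ?T q * ?D q)"
  proof (rule sum_mono)
    fix q assume "q \<in> ?I"
    then obtain i j where q: "q = (i, j)" and ij: "i \<in> {1..d}" "j \<in> {1..d}"
      by auto
    have "\<bar>?f y1 q - ?f y2 q\<bar> \<le> \<bar>?N y1 i j - ?N y2 i j\<bar> / \<tau> i j"
      unfolding q prod.case using ij by (intro exp_neg_power_Lipschitz Lp_norm_nonneg \<tau> l)
    also have "\<dots> \<le> ?D q / \<tau> i j"
      unfolding q prod.case using l y ij \<tau>[OF ij] h[OF ij]
      by (intro divide_right_mono Lp_norm_residual_diff) (auto simp: data_space_def)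
    finally show "\<bar>?f y1 q - ?f y2 q\<bar> \<le> ?T q * ?D q"
      by (simp add: q)
  qed
  also have "\<dots> \<le> (\<Sum>q\<in>?I. sum ?T ?I * ?D q)"
    using \<tau> by (intro sum_mono mult_right_mono member_le_sum) (auto intro: Lp_norm_nonneg less_imp_le)
  also have "\<dots> = sum ?T ?I * sum ?D ?I"
    by (simp add: sum_distrib_left)
  finally show ?thesis
    unfolding prod by (simp add: sum.cartesian_product)
qed

text \<open>This bound is the same for all data in a ball and keeps the normalising constants away
  from 0.\<close>

lemma neg_log_likelihood_le:
  assumes l: "l \<ge> 1" and \<tau>: "\<And>i j. i \<in> {1..d} \<Longrightarrow> j \<in> {1..d} \<Longrightarrow> \<tau> i j > 0"
    and h: "\<And>i j. i \<in> {1..d} \<Longrightarrow> j \<in> {1..d} \<Longrightarrow> h i j \<sigma> \<in> Lp l (lebesgue_on \<Omega>)"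
    and y: "y \<in> data_space \<Omega> l d"
    and r: "\<And>i j. i \<in> {1..d} \<Longrightarrow> j \<in> {1..d} \<Longrightarrow> Lp_norm l (lebesgue_on \<Omega>) (y i j) \<le> r"
  shows "neg_log_likelihood \<Omega> l d \<tau> h y \<sigma> \<le>
    (\<Sum>i=1..d. \<Sum>j=1..d. (Lp_norm l (lebesgue_on \<Omega>) (h i j \<sigma>) + r) ^ l / (real l * \<tau> i j ^ l))"
  unfolding neg_log_likelihood_def
proof (intro sum_mono divide_right_mono power_mono Lp_norm_nonneg)
  fix i j assume ij: "i \<in> {1..d}" "j \<in> {1..d}"
  have "y i j \<in> Lp l (lebesgue_on \<Omega>)"
    using y ij by (auto simp: data_space_def)
  from Lp_norm_triangle[OF l h[OF ij] Lp_minus[OF this]]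
  show "Lp_norm l (lebesgue_on \<Omega>) (\<lambda>x. h i j \<sigma> x - y i j x) \<le> Lp_norm l (lebesgue_on \<Omega>) (h i j \<sigma>) + r"
    using r[OF ij] by (simp add: Lp_norm_def)
  show "0 \<le> real l * \<tau> i j ^ l"
    using \<tau>[OF ij] by simp
qed

section \<open>Posterior measures\<close>

lemma (in prob_space) integral_positive:
  fixes f :: "'a \<Rightarrow> real"
  assumes "integrable M f" "\<And>x. x \<in> space M \<Longrightarrow> 0 < f x"
  shows "0 < (\<integral>x. f x \<partial>M)"
proof (rule ccontr)
  have nonneg: "AE x in M. 0 \<le> f x"
    using assms(2) by (auto intro!: AE_I2 less_imp_le)
  assume "\<not> ?thesis"
  then have "(\<integral>x. f x \<partial>M) = 0"
    using integral_nonneg_AE[OF nonneg] by simp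
  then have "AE x in M. f x = 0"
    using integral_nonneg_eq_0_iff_AE[OF assms(1) nonneg] by simp
  then have "AE x in M. False"
    using AE_space by eventually_elim (use assms(2) in force)
  then show False by simp
qed

lemma posterior_as_density:
  assumes "prob_space P" and int: "integrable P L" and pos: "\<And>x. x \<in> space P \<Longrightarrow> 0 < L x"
  shows "posterior P L = density P (\<lambda>x. ennreal (1 / (\<integral>x. L x \<partial>P) * L x))"
proof -
  interpret prob_space P by fact
  note [measurable] = borel_measurable_integrable[OF int]
  let ?Z = "\<integral>x. L x \<partial>P"
  have Z: "0 < ?Z"
    by (rule integral_positive[OF int pos])
  have Z': "(\<integral>\<^sup>+x. ennreal (L x) \<partial>P) = ennreal ?Z"
    using pos by (intro nn_integral_eq_integral int) (auto intro!: AE_I2 less_imp_le)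
  have "(\<integral>\<^sup>+x\<in>A. ennreal (L x) \<partial>P) / (\<integral>\<^sup>+x. ennreal (L x) \<partial>P) =
      emeasure (density P (\<lambda>x. ennreal (1 / ?Z * L x))) A" if [measurable]: "A \<in> sets P" for A
  proof -
    have "emeasure (density P (\<lambda>x. ennreal (1 / ?Z * L x))) A = (\<integral>\<^sup>+x. ennreal (1 / ?Z * L x) * indicator A x \<partial>P)"
      by (rule emeasure_density) auto
    also have "\<dots> = (\<integral>\<^sup>+x. ennreal (L x) * indicator A x / ennreal ?Z \<partial>P)"
    proof (rule nn_integral_cong)
      fix x assume "x \<in> space P"
      then show "ennreal (1 / ?Z * L x) * indicator A x = ennreal (L x) * indicator A x / ennreal ?Z"
        using Z pos[of x] by (auto simp: divide_ennreal less_imp_le indicator_def)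
    qed
    also have "\<dots> = (\<integral>\<^sup>+x\<in>A. ennreal (L x) \<partial>P) / ennreal ?Z"
      by (rule nn_integral_divide) measurable
    finally show ?thesis by (simp add: Z')
  qed
  then have "posterior P L = measure_of (space P) (sets P) (emeasure (density P (\<lambda>x. ennreal (1 / ?Z * L x))))"
    unfolding posterior_def by (intro measure_of_eq sets.space_closed) (simp add: sets.sigma_sets_eq)
  also have "\<dots> = density P (\<lambda>x. ennreal (1 / ?Z * L x))"
    using measure_of_of_measure[of "density P (\<lambda>x. ennreal (1 / ?Z * L x))"] by simp
  finally show ?thesis .
qed

lemma prob_space_posterior:
  assumes "prob_space P" "integrable P L" "\<And>x. x \<in> space P \<Longrightarrow> 0 < L x"
  shows "prob_space (posterior P L)"
proof
  interpret prob_space P by fact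
  note [measurable] = borel_measurable_integrable[OF assms(2)]
  let ?Z = "\<integral>x. L x \<partial>P"
  have Z: "0 < ?Z"
    by (rule integral_positive[OF assms(2,3)])
  have "emeasure (posterior P L) (space (posterior P L)) = (\<integral>\<^sup>+x. ennreal (1 / ?Z * L x) \<partial>P)"
    by (simp add: posterior_as_density[OF assms(1,2)] assms(3) emeasure_density cong: nn_integral_cong)
  also have "\<dots> = ennreal (\<integral>x. 1 / ?Z * L x \<partial>P)"
    using assms Z by (intro nn_integral_eq_integral) (auto intro!: AE_I2 simp: less_imp_le)
  also have "\<dots> = 1"
    using Z by simp
  finally show "emeasure (posterior P L) (space (posterior P L)) = 1" .
qed

text \<open>The data have marginal density \<open>c \<integral> L x y dP\<close>, and this factor
  cancels the denominator in Bayes' formula; what is left is Tonelli's theorem.\<close>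

lemma posterior_regular_conditional_distribution:
  fixes L :: "'a \<Rightarrow> 'b \<Rightarrow> real"
  assumes "prob_space P" "sigma_finite_measure Q"
    and L[measurable]: "(\<lambda>(x, y). L x y) \<in> borel_measurable (P \<Otimes>\<^sub>M Q)"
    and int: "\<And>y. y \<in> space Q \<Longrightarrow> integrable P (\<lambda>x. L x y)"
    and pos: "\<And>x y. x \<in> space P \<Longrightarrow> y \<in> space Q \<Longrightarrow> 0 < L x y" and "0 < c"
  shows "regular_conditional_distribution P Q (joint_law P Q (\<lambda>x y. c * L x y)) (\<lambda>y. posterior P (\<lambda>x. L x y))"
  unfolding regular_conditional_distribution_def
proof (intro conjI ballI)
  let ?post = "\<lambda>y. posterior P (\<lambda>x. L x y)"
  fix y assume y: "y \<in> space Q"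
  show "prob_space (?post y)"
    using y by (intro prob_space_posterior assms(1) int pos)
  show "sets (?post y) = sets P"
    using y by (simp add: posterior_as_density[OF assms(1) int pos])
next
  interpret P: prob_space P by fact
  interpret Q: sigma_finite_measure Q by fact
  interpret pair_sigma_finite P Q ..
  let ?post = "\<lambda>y. posterior P (\<lambda>x. L x y)"
  let ?\<nu> = "joint_law P Q (\<lambda>x y. c * L x y)"
  have Lm[measurable]: "(\<lambda>q. L (fst q) (snd q)) \<in> borel_measurable (P \<Otimes>\<^sub>M Q)"
    using L by (simp add: case_prod_beta)
  have Lm'[measurable]: "(\<lambda>q. L (snd q) (fst q)) \<in> borel_measurable (Q \<Otimes>\<^sub>M P)"
    using measurable_pair_swap[OF Lm] by (simp add: case_prod_beta)
  have joint: "?\<nu> = density (P \<Otimes>\<^sub>M Q) (\<lambda>q. ennreal (c * L (fst q) (snd q)))"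
    by (simp add: joint_law_def case_prod_unfold)
  have post: "emeasure (?post y) E = (\<integral>\<^sup>+x. ennreal (1 / (\<integral>x. L x y \<partial>P) * L x y) * indicator E x \<partial>P)"
    if "y \<in> space Q" "E \<in> sets P" for y E
    unfolding posterior_as_density[OF assms(1) int[OF that(1)] pos[OF _ that(1)], simplified]
    using that borel_measurable_integrable[OF int[OF that(1)]] by (subst emeasure_density) auto
  have meas: "(\<lambda>y. emeasure (?post y) E) \<in> borel_measurable Q" if [measurable]: "E \<in> sets P" for E
    by (subst measurable_cong[OF post]) measurable
  then show "(\<lambda>y. emeasure (?post y) E) \<in> borel_measurable Q" if "E \<in> sets P" for E
    using that .
  fix E F assume E[measurable]: "E \<in> sets P" and F[measurable]: "F \<in> sets Q"
  note [measurable] = meas[OF E]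
  have snd: "snd \<in> ?\<nu> \<rightarrow>\<^sub>M Q"
    by (simp add: joint)
  have bayes: "emeasure (?post y) E * (\<integral>\<^sup>+x. ennreal (c * L x y) \<partial>P) = (\<integral>\<^sup>+x. ennreal (c * L x y) * indicator E x \<partial>P)"
    if y: "y \<in> space Q" for y
  proof -
    let ?Z = "\<integral>x. L x y \<partial>P"
    note [measurable] = borel_measurable_integrable[OF int[OF y]]
    have Z: "0 < ?Z"
      by (rule P.integral_positive[OF int[OF y] pos[OF _ y]])
    have "(\<integral>\<^sup>+x. ennreal (c * L x y) \<partial>P) = ennreal (\<integral>x. c * L x y \<partial>P)"
      using pos[OF _ y] \<open>0 < c\<close> int[OF y]
      by (intro nn_integral_eq_integral) (auto intro!: AE_I2 simp: less_imp_le)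
    then have "emeasure (?post y) E * (\<integral>\<^sup>+x. ennreal (c * L x y) \<partial>P) =
        (\<integral>\<^sup>+x. ennreal (1 / ?Z * L x y) * indicator E x * ennreal (c * ?Z) \<partial>P)"
      by (simp add: post[OF y E] nn_integral_multc)
    also have "\<dots> = (\<integral>\<^sup>+x. ennreal (c * L x y) * indicator E x \<partial>P)"
      using Z \<open>0 < c\<close> pos[OF _ y]
      by (intro nn_integral_cong) (auto simp: indicator_def less_imp_le simp flip: ennreal_mult)
    finally show ?thesis .
  qed
  have "emeasure ?\<nu> (E \<times> F) = (\<integral>\<^sup>+q. ennreal (c * L (fst q) (snd q)) * indicator (E \<times> F) q \<partial>(P \<Otimes>\<^sub>M Q))"
    unfolding joint by (rule emeasure_density) measurable
  also have "\<dots> = (\<integral>\<^sup>+y. \<integral>\<^sup>+x. ennreal (c * L x y) * indicator E x * indicator F y \<partial>P \<partial>Q)"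
    by (subst nn_integral_snd[symmetric]) (auto simp: indicator_times ac_simps)
  also have "\<dots> = (\<integral>\<^sup>+y. \<integral>\<^sup>+x. ennreal (c * L x y) * (emeasure (?post y) E * indicator F y) \<partial>P \<partial>Q)"
  proof (rule nn_integral_cong)
    fix y assume y: "y \<in> space Q"
    note [measurable] = borel_measurable_integrable[OF int[OF y]]
    have "(\<integral>\<^sup>+x. ennreal (c * L x y) * indicator E x * indicator F y \<partial>P) =
        (\<integral>\<^sup>+x. ennreal (c * L x y) * indicator E x \<partial>P) * indicator F y"
      by (rule nn_integral_multc) measurable
    also have "\<dots> = (\<integral>\<^sup>+x. ennreal (c * L x y) \<partial>P) * (emeasure (?post y) E * indicator F y)"
      unfolding bayes[OF y, symmetric] by (simp only: ac_simps)
    also have "\<dots> = (\<integral>\<^sup>+x. ennreal (c * L x y) * (emeasure (?post y) E * indicator F y) \<partial>P)"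
      by (rule nn_integral_multc[symmetric]) measurable
    finally show "(\<integral>\<^sup>+x. ennreal (c * L x y) * indicator E x * indicator F y \<partial>P) =
        (\<integral>\<^sup>+x. ennreal (c * L x y) * (emeasure (?post y) E * indicator F y) \<partial>P)" .
  qed
  also have "\<dots> = (\<integral>\<^sup>+q. ennreal (c * L (fst q) (snd q)) * (emeasure (?post (snd q)) E * indicator F (snd q)) \<partial>(P \<Otimes>\<^sub>M Q))"
    by (subst nn_integral_snd[symmetric]) auto
  also have "\<dots> = (\<integral>\<^sup>+q. emeasure (?post (snd q)) E * indicator F (snd q) \<partial>?\<nu>)"
    unfolding joint by (rule nn_integral_density[symmetric]) measurable
  also have "\<dots> = (\<integral>\<^sup>+y\<in>F. emeasure (?post y) E \<partial>distr ?\<nu> Q snd)"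
    by (rule nn_integral_distr[OF snd, symmetric]) measurable
  finally show "emeasure ?\<nu> (E \<times> F) = (\<integral>\<^sup>+y\<in>F. emeasure (?post y) E \<partial>distr ?\<nu> Q snd)" .
qed

section \<open>Hellinger distance\<close>

text \<open>The dominating measure \<open>density P f + density P g\<close> has density \<open>f +
  g\<close>, with respect to which the two Radon-Nikodym derivatives are \<open>f / (f + g)\<close>
  and \<open>g / (f + g)\<close>. Where \<open>f + g = 0\<close>, a null set of the dominating
  measure, both quotients are 0 and so is the integrand on the right.\<close>

lemma hellinger_density:
  assumes "sigma_finite_measure P"
    and [measurable]: "f \<in> borel_measurable P" "g \<in> borel_measurable P"
    and nonneg: "\<And>x. 0 \<le> f x" "\<And>x. 0 \<le> g x"
  shows "hellinger (density P (\<lambda>x. ennreal (f x))) (density P (\<lambda>x. ennreal (g x))) =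
    sqrt (1 / 2 * (\<integral>x. (sqrt (f x) - sqrt (g x))\<^sup>2 \<partial>P))"
proof -
  interpret P: sigma_finite_measure P by fact
  define N where "N = density P (\<lambda>x. ennreal (f x + g x))"
  interpret N: sigma_finite_measure N
    unfolding N_def by (subst P.sigma_finite_iff_density_finite) auto
  let ?F = "density P (\<lambda>x. ennreal (f x))" and ?G = "density P (\<lambda>x. ennreal (g x))"
  have [measurable_cong]: "sets N = sets P"
    by (simp add: N_def)
  have sum: "measure_of (space P) (sets P) (\<lambda>A. emeasure ?F A + emeasure ?G A) = N"
  proof -
    have "emeasure ?F A + emeasure ?G A = emeasure N A" if "A \<in> sets P" for A
    proof -
      have "emeasure N A = (\<integral>\<^sup>+x. ennreal (f x) * indicator A x + ennreal (g x) * indicator A x \<partial>P)"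
        unfolding N_def using that nonneg
        by (subst emeasure_density) (auto intro!: nn_integral_cong simp: indicator_def)
      also have "\<dots> = emeasure ?F A + emeasure ?G A"
        using that by (subst nn_integral_add) (auto simp: emeasure_density)
      finally show ?thesis by simp
    qed
    then have "measure_of (space P) (sets P) (\<lambda>A. emeasure ?F A + emeasure ?G A) =
        measure_of (space P) (sets P) (emeasure N)"
      by (intro measure_of_eq sets.space_closed) (simp add: sets.sigma_sets_eq)
    also have "\<dots> = N"
      using measure_of_of_measure[of N] by (simp add: N_def)
    finally show ?thesis .
  qed
  have RN: "AE x in N. RN_deriv N (density P (\<lambda>x. ennreal (k x))) x = ennreal (k x / (f x + g x))"
    if [measurable]: "k \<in> borel_measurable P" and k: "\<And>x. 0 \<le> k x" "\<And>x. k x \<le> f x + g x" for k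
  proof -
    have "density N (\<lambda>x. ennreal (k x / (f x + g x))) = density P (\<lambda>x. ennreal (f x + g x) * ennreal (k x / (f x + g x)))"
      unfolding N_def by (rule density_density_eq) measurable
    also have "\<dots> = density P (\<lambda>x. ennreal (k x))"
    proof (rule arg_cong[where f="density P"], rule ext)
      fix x
      have "(f x + g x) * (k x / (f x + g x)) = k x"
        using k[of x] by (cases "f x + g x = 0") auto
      moreover have "0 \<le> f x + g x" "0 \<le> k x / (f x + g x)"
        using nonneg[of x] k(1)[of x] by simp_all
      ultimately show "ennreal (f x + g x) * ennreal (k x / (f x + g x)) = ennreal (k x)"
        by (metis ennreal_mult)
    qed
    finally show ?thesis
      using N.RN_deriv_unique[of "\<lambda>x. ennreal (k x / (f x + g x))"] by (auto elim!: eventually_mono)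
  qed
  have "AE x in N. (sqrt (enn2real (RN_deriv N ?F x)) - sqrt (enn2real (RN_deriv N ?G x)))\<^sup>2 =
      (sqrt (f x / (f x + g x)) - sqrt (g x / (f x + g x)))\<^sup>2"
    using RN[of f, OF _ nonneg(1)] RN[of g, OF _ nonneg(2)] nonneg
    by (auto simp: divide_nonneg_nonneg elim!: eventually_elim2)
  then have "(\<integral>x. (sqrt (enn2real (RN_deriv N ?F x)) - sqrt (enn2real (RN_deriv N ?G x)))\<^sup>2 \<partial>N) =
      (\<integral>x. (sqrt (f x / (f x + g x)) - sqrt (g x / (f x + g x)))\<^sup>2 \<partial>N)"
    by (intro integral_cong_AE) auto
  also have "\<dots> = (\<integral>x. (f x + g x) *\<^sub>R (sqrt (f x / (f x + g x)) - sqrt (g x / (f x + g x)))\<^sup>2 \<partial>P)"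
    unfolding N_def using nonneg by (intro integral_density) auto
  also have "\<dots> = (\<integral>x. (sqrt (f x) - sqrt (g x))\<^sup>2 \<partial>P)"
  proof (rule Bochner_Integration.integral_cong[OF refl])
    fix x
    show "(f x + g x) *\<^sub>R (sqrt (f x / (f x + g x)) - sqrt (g x / (f x + g x)))\<^sup>2 = (sqrt (f x) - sqrt (g x))\<^sup>2"
    proof (cases "f x + g x = 0")
      case True
      then have "f x = 0" "g x = 0" using nonneg[of x] by linarith+
      then show ?thesis by simp
    next
      case False
      then show ?thesis
        using nonneg[of x] by (simp add: real_sqrt_divide diff_divide_distrib[symmetric] power_divide)
    qed
  qed
  finally show ?thesis
    unfolding hellinger_def by (simp add: sum Let_def)
qed

text \<open>Here \<open>a\<close>, \<open>b\<close> are values of two root likelihoods and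
  \<open>s\<^sup>2\<close>, \<open>t\<^sup>2\<close> are the normalising constants. Both parts of
  \<open>a / s - b / t = (a - b) / s + b (t - s) / (s t)\<close> are of order \<open>D\<close>, the
  second because \<open>|s - t| (s + t) = |s\<^sup>2 - t\<^sup>2|\<close>.\<close>

lemma root_likelihood_normalized_diff:
  fixes a b s t z D :: real
  assumes "0 \<le> a" "0 \<le> b" "b \<le> 1" "\<bar>a - b\<bar> \<le> D" "0 < z" "z \<le> s\<^sup>2" "z \<le> t\<^sup>2" "0 < s" "0 < t"
    and "\<bar>s\<^sup>2 - t\<^sup>2\<bar> \<le> 2 * D"
  shows "\<bar>a / s - b / t\<bar> \<le> (1 / sqrt z + 1 / (z * sqrt z)) * D"
proof -
  have st: "sqrt z \<le> s" "sqrt z \<le> t"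
    using assms by (auto intro: real_le_lsqrt)
  have D: "0 \<le> D" using assms(4) by linarith
  have "\<bar>s - t\<bar> * (s + t) = \<bar>(s - t) * (s + t)\<bar>"
    using assms(8,9) by (simp add: abs_mult)
  also have "(s - t) * (s + t) = s\<^sup>2 - t\<^sup>2"
    by (simp add: power2_eq_square algebra_simps)
  finally have "\<bar>s - t\<bar> * (s + t) \<le> 2 * D"
    using assms(10) by linarith
  moreover have "\<bar>s - t\<bar> * (2 * sqrt z) \<le> \<bar>s - t\<bar> * (s + t)"
    using st by (intro mult_left_mono) auto
  ultimately have diff: "\<bar>s - t\<bar> \<le> D / sqrt z"
    using \<open>0 < z\<close> by (simp add: pos_le_divide_eq)
  have eq: "a / s - b / t = (a - b) / s + b * (t - s) / (s * t)"
    using assms(8,9) by (simp add: field_simps)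
  have "\<bar>(a - b) / s\<bar> \<le> D / sqrt z"
    unfolding abs_divide using assms st by (intro frac_le) auto
  moreover have "\<bar>b * (t - s) / (s * t)\<bar> \<le> (D / sqrt z) / z"
    unfolding abs_divide
  proof (rule frac_le)
    have "\<bar>b * (t - s)\<bar> \<le> 1 * (D / sqrt z)"
      unfolding abs_mult using assms diff by (intro mult_mono) (auto simp: abs_minus_commute)
    then show "\<bar>b * (t - s)\<bar> \<le> D / sqrt z" by simp
    have "sqrt z * sqrt z \<le> s * t"
      using st assms by (intro mult_mono) auto
    then show "z \<le> \<bar>s * t\<bar>" using assms by simp
  qed (use assms D in auto)
  ultimately show ?thesis
    unfolding eq using abs_triangle_ineq[of "(a - b) / s" "b * (t - s) / (s * t)"]
    by (simp add: algebra_simps)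
qed

text \<open>If the root likelihoods differ by at most \<open>D\<close>, then the likelihoods,
  being their squares with roots at most 1, and hence the normalising constants differ by at most
  \<open>2 * D\<close>. So the roots of the posterior densities are uniformly close.\<close>

lemma hellinger_posterior_le:
  fixes \<Phi> \<Psi> :: "'a \<Rightarrow> real"
  assumes "prob_space P" and [measurable]: "\<Phi> \<in> borel_measurable P" "\<Psi> \<in> borel_measurable P"
    and nonneg: "\<And>x. 0 \<le> \<Phi> x" "\<And>x. 0 \<le> \<Psi> x"
    and "0 < z" "z \<le> (\<integral>x. exp (- \<Phi> x) \<partial>P)" "z \<le> (\<integral>x. exp (- \<Psi> x) \<partial>P)"
    and D: "\<And>x. x \<in> space P \<Longrightarrow> \<bar>exp (- (\<Phi> x / 2)) - exp (- (\<Psi> x / 2))\<bar> \<le> D"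
  shows "hellinger (posterior P (\<lambda>x. exp (- \<Phi> x))) (posterior P (\<lambda>x. exp (- \<Psi> x)))
    \<le> (1 / sqrt z + 1 / (z * sqrt z)) * D"
proof -
  interpret prob_space P by fact
  let ?B = "(1 / sqrt z + 1 / (z * sqrt z)) * D"
  let ?Z1 = "\<integral>x. exp (- \<Phi> x) \<partial>P" and ?Z2 = "\<integral>x. exp (- \<Psi> x) \<partial>P"
  have int: "integrable P (\<lambda>x. exp (- \<Phi> x))" "integrable P (\<lambda>x. exp (- \<Psi> x))"
    using nonneg by (auto intro!: integrable_const_bound[where B=1])
  have sq: "exp (- v) = (exp (- (v / 2)))\<^sup>2" for v :: real
    by (simp flip: exp_double)
  have "\<bar>exp (- \<Phi> x) - exp (- \<Psi> x)\<bar> \<le> 2 * D" if "x \<in> space P" for x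
  proof -
    let ?a = "exp (- (\<Phi> x / 2))" and ?b = "exp (- (\<Psi> x / 2))"
    have "?a \<le> 1" "?b \<le> 1"
      using nonneg[of x] by auto
    then have "\<bar>?a + ?b\<bar> \<le> 2"
      using exp_ge_zero[of "- (\<Phi> x / 2)"] exp_ge_zero[of "- (\<Psi> x / 2)"] by linarith
    then have "\<bar>?a - ?b\<bar> * \<bar>?a + ?b\<bar> \<le> D * 2"
      using D[OF that] by (intro mult_mono) auto
    then show ?thesis
      unfolding sq[of "\<Phi> x"] sq[of "\<Psi> x"] square_diff_square_factored power2_eq_square abs_mult
      by (simp add: mult.commute)
  qed
  then have "(\<integral>x. \<bar>exp (- \<Phi> x) - exp (- \<Psi> x)\<bar> \<partial>P) \<le> (\<integral>x. 2 * D \<partial>P)"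
    using int by (intro integral_mono) auto
  moreover have "\<bar>?Z1 - ?Z2\<bar> \<le> (\<integral>x. \<bar>exp (- \<Phi> x) - exp (- \<Psi> x)\<bar> \<partial>P)"
    using integral_abs_bound[of P "\<lambda>x. exp (- \<Phi> x) - exp (- \<Psi> x)"] int by simp
  ultimately have Z_diff: "\<bar>?Z1 - ?Z2\<bar> \<le> 2 * D"
    by (simp add: prob_space)
  have Z: "0 < ?Z1" "0 < ?Z2"
    using assms by linarith+
  let ?f = "\<lambda>x. 1 / ?Z1 * exp (- \<Phi> x)" and ?g = "\<lambda>x. 1 / ?Z2 * exp (- \<Psi> x)"
  have root: "sqrt (1 / Z * exp (- v)) = exp (- (v / 2)) / sqrt Z" for v Z :: real
    unfolding sq[of v] by (simp add: real_sqrt_divide)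
  have pointwise: "\<bar>sqrt (?f x) - sqrt (?g x)\<bar> \<le> ?B" if "x \<in> space P" for x
    unfolding root using nonneg[of x] D[OF that] Z Z_diff assms
    by (intro root_likelihood_normalized_diff) auto
  have "(\<integral>x. (sqrt (?f x) - sqrt (?g x))\<^sup>2 \<partial>P) \<le> (\<integral>x. ?B\<^sup>2 \<partial>P)"
  proof (rule integral_mono_AE')
    show "AE x in P. (sqrt (?f x) - sqrt (?g x))\<^sup>2 \<le> ?B\<^sup>2"
      using pointwise by (intro AE_I2) (metis abs_ge_zero power2_abs power_mono)
  qed auto
  also have "\<dots> = ?B\<^sup>2"
    by (simp add: prob_space)
  finally have "1 / 2 * (\<integral>x. (sqrt (?f x) - sqrt (?g x))\<^sup>2 \<partial>P) \<le> ?B\<^sup>2"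
    using zero_le_power2[of ?B] by linarith
  moreover have "0 \<le> ?B"
    using pointwise not_empty by (metis abs_ge_zero ex_in_conv order_trans)
  moreover have "hellinger (posterior P (\<lambda>x. exp (- \<Phi> x))) (posterior P (\<lambda>x. exp (- \<Psi> x))) =
      sqrt (1 / 2 * (\<integral>x. (sqrt (?f x) - sqrt (?g x))\<^sup>2 \<partial>P))"
  proof -
    have "posterior P (\<lambda>x. exp (- \<Phi> x)) = density P (\<lambda>x. ennreal (?f x))"
      "posterior P (\<lambda>x. exp (- \<Psi> x)) = density P (\<lambda>x. ennreal (?g x))"
      by (rule posterior_as_density[OF prob_space_axioms int(1)], simp,
          rule posterior_as_density[OF prob_space_axioms int(2)], simp)
    moreover have "0 \<le> ?f x" "0 \<le> ?g x" for x
      using Z by auto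
    ultimately show ?thesis
      using hellinger_density[OF sigma_finite_measure_axioms, of ?f ?g] by simp
  qed
  ultimately show ?thesis
    by (simp only: real_le_lsqrt)
qed

section \<open>Well-posedness of the Bayesian inverse problem\<close>

theorem theorem6p6:
  fixes \<Omega> :: "(real^2) set" and d p l :: nat
    and g :: "nat \<Rightarrow> real^2 \<Rightarrow> real" and \<tau> :: "nat \<Rightarrow> nat \<Rightarrow> real"
    and \<sigma>min \<sigma>max \<sigma>minus \<sigma>plus a :: real
    and S :: "(real^2 \<Rightarrow> real) set"
    and u :: "nat \<Rightarrow> (real^2 \<Rightarrow> real) \<Rightarrow> real^2 \<Rightarrow> real"
    and M :: "'w measure" and X :: "'w \<Rightarrow> 'h::{real_inner,complete_space}"
    and J :: "'h \<Rightarrow> real^2 \<Rightarrow> real" and C :: "'h \<Rightarrow> 'h"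
    and h :: "nat \<Rightarrow> nat \<Rightarrow> (real^2 \<Rightarrow> real) \<Rightarrow> real^2 \<Rightarrow> real"
    and \<Phi> :: "(nat \<Rightarrow> nat \<Rightarrow> real^2 \<Rightarrow> real) \<Rightarrow> (real^2 \<Rightarrow> real) \<Rightarrow> real"
    and F :: "'w \<Rightarrow> real^2 \<Rightarrow> real" and P :: "(real^2 \<Rightarrow> real) measure"
  assumes h_eq: "h = (\<lambda>i j \<sigma>. power_density \<Omega> \<sigma> (u i \<sigma>) (u j \<sigma>))"
    and Phi_eq: "\<Phi> = neg_log_likelihood \<Omega> l d \<tau> h"
    and F_eq: "F = (\<lambda>\<omega> x. conductivity_map p \<sigma>minus \<sigma>plus a (J (X \<omega>) x))"
    and P_eq: "P = distr M (Linf_borel \<Omega> S) F"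
    and "p \<in> {1, 2, 3}" and "l \<in> {1, 2}" and "d \<ge> 1"
    and "open \<Omega>" and "bounded \<Omega>" and "lipschitz_boundary \<Omega>"
    and "0 < \<sigma>min" and "\<sigma>min < \<sigma>max" and "0 < \<sigma>minus" and "0 < \<sigma>plus" and "0 < a"
    and "\<And>i j. i \<in> {1..d} \<Longrightarrow> j \<in> {1..d} \<Longrightarrow> \<tau> i j > 0"
    and "\<And>\<sigma>. \<sigma> \<in> S \<Longrightarrow> \<sigma> \<in> borel_measurable (lebesgue_on \<Omega>)"
    and "\<And>\<sigma>. \<sigma> \<in> S \<Longrightarrow> AE x in lebesgue_on \<Omega>. \<sigma>min < \<sigma> x \<and> \<sigma> x < \<sigma>max"
    and "\<And>\<sigma> i. \<sigma> \<in> S \<Longrightarrow> i \<in> {1..d} \<Longrightarrow> weak_solution \<Omega> \<sigma> (g i) (u i \<sigma>)"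
    and "l = 1 \<Longrightarrow> \<forall>i\<in>{1..d}. g i \<in> boundary_sobolev \<Omega> (1/2)"
    and "l = 2 \<Longrightarrow> \<exists>s>1. \<forall>i\<in>{1..d}. g i \<in> boundary_sobolev \<Omega> (s + 1/2)"
    and "l = 2 \<Longrightarrow> \<forall>\<sigma>\<in>S. \<forall>i\<in>{1..d}. \<forall>j\<in>{1..d}. h i j \<sigma> \<in> Lp 2 (lebesgue_on \<Omega>)"
    and "function_space \<Omega> J" and "covariance_operator C" and "centred_gaussian M C X"
    and "F \<in> measurable M (Linf_borel \<Omega> S)"
  shows
    "(\<forall>y\<in>data_space \<Omega> l d.
       integrable P (\<lambda>\<sigma>. exp (- \<Phi> y \<sigma>)) \<and>
       (\<integral>\<sigma>. exp (- \<Phi> y \<sigma>) \<partial>P) > 0 \<and>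
       prob_space (posterior P (\<lambda>\<sigma>. exp (- \<Phi> y \<sigma>))) \<and>
       sets (posterior P (\<lambda>\<sigma>. exp (- \<Phi> y \<sigma>))) = sets P \<and>
       absolutely_continuous P (posterior P (\<lambda>\<sigma>. exp (- \<Phi> y \<sigma>))) \<and>
       posterior P (\<lambda>\<sigma>. exp (- \<Phi> y \<sigma>)) =
         density P (\<lambda>\<sigma>. ennreal (1 / (\<integral>\<sigma>. exp (- \<Phi> y \<sigma>) \<partial>P) * exp (- \<Phi> y \<sigma>))) \<and>
       (AE \<sigma> in P. RN_deriv P (posterior P (\<lambda>\<sigma>. exp (- \<Phi> y \<sigma>))) \<sigma> =
         ennreal (1 / (\<integral>\<sigma>. exp (- \<Phi> y \<sigma>) \<partial>P) * exp (- \<Phi> y \<sigma>)))) \<and>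
     (\<forall>(Q :: (nat \<Rightarrow> nat \<Rightarrow> real^2 \<Rightarrow> real) measure) c.
       sigma_finite_measure Q \<and> space Q = data_space \<Omega> l d \<and>
       (\<lambda>(\<sigma>, y). \<Phi> y \<sigma>) \<in> borel_measurable (P \<Otimes>\<^sub>M Q) \<and> c > 0 \<and>
       (\<forall>\<sigma>\<in>S. (\<integral>\<^sup>+y. ennreal (c * exp (- \<Phi> y \<sigma>)) \<partial>Q) = 1) \<longrightarrow>
       regular_conditional_distribution P Q
         (joint_law P Q (\<lambda>\<sigma> y. c * exp (- \<Phi> y \<sigma>)))
         (\<lambda>y. posterior P (\<lambda>\<sigma>. exp (- \<Phi> y \<sigma>)))) \<and>
     (\<forall>r>0. \<exists>K>0. \<forall>y1\<in>data_space \<Omega> l d. \<forall>y2\<in>data_space \<Omega> l d.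
       (\<forall>i\<in>{1..d}. \<forall>j\<in>{1..d}. Lp_norm l (lebesgue_on \<Omega>) (y1 i j) < r \<and>
                                Lp_norm l (lebesgue_on \<Omega>) (y2 i j) < r) \<longrightarrow>
       hellinger (posterior P (\<lambda>\<sigma>. exp (- \<Phi> y1 \<sigma>))) (posterior P (\<lambda>\<sigma>. exp (- \<Phi> y2 \<sigma>)))
         \<le> K * (\<Sum>i=1..d. \<Sum>j=1..d. Lp_norm l (lebesgue_on \<Omega>) (\<lambda>x. y1 i j x - y2 i j x)))"
proof -
  note l = \<open>l \<in> {1, 2}\<close> and \<Omega> = \<open>open \<Omega>\<close> \<open>bounded \<Omega>\<close>
  note \<tau> = \<open>\<And>i j. i \<in> {1..d} \<Longrightarrow> j \<in> {1..d} \<Longrightarrow> \<tau> i j > 0\<close>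
  note meas = \<open>\<And>\<sigma>. \<sigma> \<in> S \<Longrightarrow> \<sigma> \<in> borel_measurable (lebesgue_on \<Omega>)\<close>
  note bounds = \<open>\<And>\<sigma>. \<sigma> \<in> S \<Longrightarrow> AE x in lebesgue_on \<Omega>. \<sigma>min < \<sigma> x \<and> \<sigma> x < \<sigma>max\<close>
  note sol = \<open>\<And>\<sigma> i. \<sigma> \<in> S \<Longrightarrow> i \<in> {1..d} \<Longrightarrow> weak_solution \<Omega> \<sigma> (g i) (u i \<sigma>)\<close>
  let ?M = "lebesgue_on \<Omega>"
  have "prob_space M"
    using \<open>centred_gaussian M C X\<close> by (simp add: centred_gaussian_def)
  then interpret P: prob_space P
    unfolding P_eq using \<open>F \<in> measurable M (Linf_borel \<Omega> S)\<close> by (rule prob_space.prob_space_distr)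
  have space_P: "space P = S" and sets_P[measurable_cong]: "sets P = sets (Linf_borel \<Omega> S)"
    by (simp_all add: P_eq space_Linf_borel)
  have h: "h i j \<sigma> \<in> Lp l ?M" if "\<sigma> \<in> S" "i \<in> {1..d}" "j \<in> {1..d}" for i j \<sigma>
  proof (cases "l = 1")
    case True
    \<comment> \<open>for \<open>l = 1\<close> integrability is automatic: bounded conductivity times a product of \<open>L\<^sup>2\<close> gradients\<close>
    have "AE x in ?M. 0 < \<sigma> x \<and> \<sigma> x < \<sigma>max"
      using bounds[OF that(1)] \<open>0 < \<sigma>min\<close> by (auto elim: eventually_mono)
    then show ?thesis
      unfolding h_eq True
      by (rule power_density_L1[OF meas[OF that(1)] _ sol[OF that(1,2)] sol[OF that(1,3)]])
  next
    case False
    then show ?thesis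
      using assms(22) that l by auto
  qed
  have norm_meas: "(\<lambda>\<sigma>. Lp_norm l ?M (\<lambda>x. h i j \<sigma> x - k x)) \<in> borel_measurable P"
    if "i \<in> {1..d}" "j \<in> {1..d}" "k \<in> borel_measurable ?M" for i j k
    unfolding h_eq measurable_cong_sets[OF sets_P refl]
    by (rule residual_norm_measurable[OF \<Omega> \<open>0 < \<sigma>min\<close> meas bounds sol[OF _ that(1)] sol[OF _ that(2)] that(3)])
  have Phi_meas[measurable]: "\<Phi> y \<in> borel_measurable P" if "y \<in> data_space \<Omega> l d" for y
    unfolding Phi_eq neg_log_likelihood_def using that
    by (intro borel_measurable_sum borel_measurable_divide borel_measurable_power norm_meas
        borel_measurable_const) (auto simp: data_space_def Lp_def)
  have Phi_nonneg: "0 \<le> \<Phi> y \<sigma>" for y \<sigma>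
    unfolding Phi_eq by (rule neg_log_likelihood_nonneg[OF \<tau>])
  have int: "integrable P (\<lambda>\<sigma>. exp (- \<Phi> y \<sigma>))" if "y \<in> data_space \<Omega> l d" for y
    using Phi_nonneg Phi_meas[OF that] by (intro P.integrable_const_bound[where B=1]) auto
  have Z: "0 < (\<integral>\<sigma>. exp (- \<Phi> y \<sigma>) \<partial>P)" if "y \<in> data_space \<Omega> l d" for y
    by (rule P.integral_positive[OF int[OF that]]) simp
  have post: "posterior P (\<lambda>\<sigma>. exp (- \<Phi> y \<sigma>)) =
      density P (\<lambda>\<sigma>. ennreal (1 / (\<integral>\<sigma>. exp (- \<Phi> y \<sigma>) \<partial>P) * exp (- \<Phi> y \<sigma>)))"
    if "y \<in> data_space \<Omega> l d" for y
    by (rule posterior_as_density[OF P.prob_space_axioms int[OF that]]) simp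
  have bayes: "integrable P (\<lambda>\<sigma>. exp (- \<Phi> y \<sigma>)) \<and>
       (\<integral>\<sigma>. exp (- \<Phi> y \<sigma>) \<partial>P) > 0 \<and>
       prob_space (posterior P (\<lambda>\<sigma>. exp (- \<Phi> y \<sigma>))) \<and>
       sets (posterior P (\<lambda>\<sigma>. exp (- \<Phi> y \<sigma>))) = sets P \<and>
       absolutely_continuous P (posterior P (\<lambda>\<sigma>. exp (- \<Phi> y \<sigma>))) \<and>
       posterior P (\<lambda>\<sigma>. exp (- \<Phi> y \<sigma>)) =
         density P (\<lambda>\<sigma>. ennreal (1 / (\<integral>\<sigma>. exp (- \<Phi> y \<sigma>) \<partial>P) * exp (- \<Phi> y \<sigma>))) \<and>
       (AE \<sigma> in P. RN_deriv P (posterior P (\<lambda>\<sigma>. exp (- \<Phi> y \<sigma>))) \<sigma> =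
         ennreal (1 / (\<integral>\<sigma>. exp (- \<Phi> y \<sigma>) \<partial>P) * exp (- \<Phi> y \<sigma>)))"
    if y: "y \<in> data_space \<Omega> l d" for y
  proof (intro conjI int[OF y] Z[OF y] post[OF y])
    let ?f = "\<lambda>\<sigma>. ennreal (1 / (\<integral>\<sigma>. exp (- \<Phi> y \<sigma>) \<partial>P) * exp (- \<Phi> y \<sigma>))"
    have f: "?f \<in> borel_measurable P"
      using Phi_meas[OF y] by measurable
    show "prob_space (posterior P (\<lambda>\<sigma>. exp (- \<Phi> y \<sigma>)))"
      by (rule prob_space_posterior[OF P.prob_space_axioms int[OF y]]) simp
    show "sets (posterior P (\<lambda>\<sigma>. exp (- \<Phi> y \<sigma>))) = sets P"
      by (simp add: post[OF y])
    show "absolutely_continuous P (posterior P (\<lambda>\<sigma>. exp (- \<Phi> y \<sigma>)))"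
      unfolding post[OF y] by (rule absolutely_continuousI_density[OF f])
    show "AE \<sigma> in P. RN_deriv P (posterior P (\<lambda>\<sigma>. exp (- \<Phi> y \<sigma>))) \<sigma> = ?f \<sigma>"
      using P.RN_deriv_unique[OF f post[OF y, symmetric]] by (rule eventually_mono) (rule sym)
  qed
  have conditional: "regular_conditional_distribution P Q (joint_law P Q (\<lambda>\<sigma> y. c * exp (- \<Phi> y \<sigma>)))
      (\<lambda>y. posterior P (\<lambda>\<sigma>. exp (- \<Phi> y \<sigma>)))"
    if "sigma_finite_measure Q" "space Q = data_space \<Omega> l d"
      "(\<lambda>(\<sigma>, y). \<Phi> y \<sigma>) \<in> borel_measurable (P \<Otimes>\<^sub>M Q)" "c > 0"
    for Q :: "(nat \<Rightarrow> nat \<Rightarrow> real^2 \<Rightarrow> real) measure" and c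
  proof (rule posterior_regular_conditional_distribution[OF P.prob_space_axioms that(1)])
    have "(\<lambda>q. exp (- (case q of (\<sigma>, y) \<Rightarrow> \<Phi> y \<sigma>))) \<in> borel_measurable (P \<Otimes>\<^sub>M Q)"
      using that(3) by measurable
    then show "(\<lambda>(\<sigma>, y). exp (- \<Phi> y \<sigma>)) \<in> borel_measurable (P \<Otimes>\<^sub>M Q)"
      by (simp add: case_prod_unfold)
  qed (use that int in auto)
  have stability: "\<exists>K>0. \<forall>y1\<in>data_space \<Omega> l d. \<forall>y2\<in>data_space \<Omega> l d.
       (\<forall>i\<in>{1..d}. \<forall>j\<in>{1..d}. Lp_norm l ?M (y1 i j) < r \<and> Lp_norm l ?M (y2 i j) < r) \<longrightarrow>
       hellinger (posterior P (\<lambda>\<sigma>. exp (- \<Phi> y1 \<sigma>))) (posterior P (\<lambda>\<sigma>. exp (- \<Phi> y2 \<sigma>)))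
         \<le> K * (\<Sum>i=1..d. \<Sum>j=1..d. Lp_norm l ?M (\<lambda>x. y1 i j x - y2 i j x))"
    if "r > 0" for r
  proof -
    \<comment> \<open>pointwise upper bound of \<open>\<Phi>\<close> over the ball of data, which need not be bounded in \<open>\<sigma>\<close>\<close>
    define B where "B \<sigma> = (\<Sum>i=1..d. \<Sum>j=1..d. (Lp_norm l ?M (h i j \<sigma>) + r) ^ l / (real l * \<tau> i j ^ l))" for \<sigma>
    define z where "z = (\<integral>\<sigma>. exp (- B \<sigma>) \<partial>P)"
    define T where "T = (\<Sum>i=1..d. \<Sum>j=1..d. 1 / \<tau> i j)"
    have B_meas: "B \<in> borel_measurable P"
      unfolding B_def using norm_meas[of _ _ "\<lambda>_. 0"]
      by (intro borel_measurable_sum borel_measurable_divide borel_measurable_power borel_measurable_add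
          borel_measurable_const) simp
    have "0 \<le> B \<sigma>" for \<sigma>
      unfolding B_def using \<open>r > 0\<close>
      by (intro sum_nonneg divide_nonneg_nonneg mult_nonneg_nonneg zero_le_power add_nonneg_nonneg
          Lp_norm_nonneg of_nat_0_le_iff \<tau>[THEN less_imp_le]) auto
    then have B_int: "integrable P (\<lambda>\<sigma>. exp (- B \<sigma>))"
      using B_meas by (intro P.integrable_const_bound[where B=1]) auto
    have "0 < z"
      unfolding z_def by (rule P.integral_positive[OF B_int]) simp
    have z_le: "z \<le> (\<integral>\<sigma>. exp (- \<Phi> y \<sigma>) \<partial>P)"
      if y: "y \<in> data_space \<Omega> l d" and r: "\<forall>i\<in>{1..d}. \<forall>j\<in>{1..d}. Lp_norm l ?M (y i j) < r" for y
      unfolding z_def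
    proof (rule integral_mono[OF B_int int[OF y]])
      fix \<sigma> assume "\<sigma> \<in> space P"
      then have "\<Phi> y \<sigma> \<le> B \<sigma>"
        unfolding Phi_eq B_def using l r
        by (intro neg_log_likelihood_le \<tau> h y) (auto simp: space_P less_imp_le)
      then show "exp (- B \<sigma>) \<le> exp (- \<Phi> y \<sigma>)" by simp
    qed
    have "0 < T"
      unfolding T_def using \<open>d \<ge> 1\<close> \<tau> by (intro sum_pos) auto
    let ?K = "(1 / sqrt z + 1 / (z * sqrt z)) * T"
    have "hellinger (posterior P (\<lambda>\<sigma>. exp (- \<Phi> y1 \<sigma>))) (posterior P (\<lambda>\<sigma>. exp (- \<Phi> y2 \<sigma>)))
         \<le> ?K * (\<Sum>i=1..d. \<Sum>j=1..d. Lp_norm l ?M (\<lambda>x. y1 i j x - y2 i j x))"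
      if y: "y1 \<in> data_space \<Omega> l d" "y2 \<in> data_space \<Omega> l d"
        and r: "\<forall>i\<in>{1..d}. \<forall>j\<in>{1..d}. Lp_norm l ?M (y1 i j) < r \<and> Lp_norm l ?M (y2 i j) < r" for y1 y2
    proof -
      have root: "\<bar>exp (- (\<Phi> y1 \<sigma> / 2)) - exp (- (\<Phi> y2 \<sigma> / 2))\<bar>
          \<le> T * (\<Sum>i=1..d. \<Sum>j=1..d. Lp_norm l ?M (\<lambda>x. y1 i j x - y2 i j x))" if "\<sigma> \<in> space P" for \<sigma>
        unfolding Phi_eq T_def using that by (intro root_likelihood_Lipschitz l \<tau> h y) (simp_all add: space_P)
      show ?thesis
        using hellinger_posterior_le[OF P.prob_space_axioms Phi_meas[OF y(1)] Phi_meas[OF y(2)]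
            Phi_nonneg Phi_nonneg \<open>0 < z\<close> z_le[OF y(1)] z_le[OF y(2)] root] r
        by (simp add: mult.assoc)
    qed
    moreover have "?K > 0"
      using \<open>0 < z\<close> \<open>0 < T\<close> by (intro mult_pos_pos add_pos_pos) auto
    ultimately show ?thesis by blast
  qed
  show ?thesis
    by (rule conjI[OF ballI[OF bayes] conjI], assumption, intro allI impI, elim conjE,
        rule conditional, assumption+, intro allI impI, rule stability)
qed

end
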